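(* Let $X$ be a complex Banach space. Suppose that $(R(t))_{t>0}\subseteq L(X)$ is strongly continuous and $\|R(t)\|=O(e^{-\omega t}t^{\beta-1})$, $t>0$, for some numbers $\omega>0$ and $\beta>0$. Let $f\in AAPS^q([0,\infty):X)$ with some $q\in[1,\infty)$, let $1/q+1/q'=1$, and suppose that $$q'(\beta-1)>-1\ \text{ provided } q>1,\qquad\text{and}\qquad \beta=1\ \text{ provided } q=1.$$ Define $$H(t):=\int_0^tR(t-s)f(s)\,ds,\quad t\ge0.$$ Then $H\in AAP([0,\infty):X)$.
   Context: $L(X)$ is the space of bounded linear operators on $X$. The bound $\|R(t)\|=O(e^{-\omega t}t^{\beta-1})$, $t>0$, means that there is a finite constant $C$ with $\|R(t)\|\le Ce^{-\omega t}t^{\beta-1}$ for all $t>0$. For a Banach space $Z$, $AAP([0,\infty):Z)$ is the set of bounded continuous $u:[0,\infty)\to Z$ such that for every $\epsilon>0$ there are $l>0$, $M>0$ such that every subinterval of $[0,\infty)$ of length $l$ contains a number $\tau$ with $\|u(t+\tau)-u(t)\|\le\epsilon$ for all $t\ge M$ (asymptotically almost periodic functions). For $1\le q<\infty$, $AAPS^q([0,\infty):X)$ is the set of $f\in L^q_{loc}([0,\infty):X)$ with $\sup_{t\ge0}\left(\int_t^{t+1}\|f(s)\|^q\,ds\right)^{1/q}<\infty$ such that $\hat f:[0,\infty)\to L^q([0,1]:X)$, $\hat f(t):=f(t+\cdot)$, is asymptotically almost periodic. *)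

theory Defs
  imports "HOL-Analysis.Analysis"
begin

class complex_banach = banach +
  fixes scaleC :: "complex \<Rightarrow> 'a \<Rightarrow> 'a"  (infixr \<open>*\<^sub>C\<close> 75)
  assumes scaleC_add_right: "c *\<^sub>C (x + y) = c *\<^sub>C x + c *\<^sub>C y"
    and scaleC_add_left: "(c + d) *\<^sub>C x = c *\<^sub>C x + d *\<^sub>C x"
    and scaleC_scaleC: "c *\<^sub>C (d *\<^sub>C x) = (c * d) *\<^sub>C x"
    and scaleC_one: "1 *\<^sub>C x = x"
    and scaleR_scaleC: "scaleR r x = complex_of_real r *\<^sub>C x"
    and norm_scaleC: "norm (c *\<^sub>C x) = cmod c * norm x"

instantiation complex :: complex_banach
begin

definition scaleC_complex :: "complex \<Rightarrow> complex \<Rightarrow> complex"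
  where "scaleC_complex c x = c * x"

instance
  by standard (simp_all add: scaleC_complex_def algebra_simps norm_mult scaleR_conv_of_real)

end

text \<open>The library type of bounded linear maps only records real linearity; its norm is the
  operator norm.\<close>

definition complex_operators :: "('a::complex_banach \<Rightarrow>\<^sub>L 'a) set"
  where "complex_operators = {T. \<forall>c x. blinfun_apply T (c *\<^sub>C x) = c *\<^sub>C blinfun_apply T x}"


text \<open>The Bochner integral of the library is restricted to second countable (that is, separable)
  spaces.  Without separability, Borel measurability has to be replaced by strong measurability;
  apart from that the definitions are those of the library.\<close>

definition strongly_measurable :: "'b measure \<Rightarrow> ('b \<Rightarrow> 'a::real_normed_vector) \<Rightarrow> bool"
  where "strongly_measurable M f \<longleftrightarrow>
    (\<exists>s. (\<forall>i::nat. simple_function M (s i)) \<and> (AE x in M. (\<lambda>i. s i x) \<longlonglongrightarrow> f x))"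

definition has_strong_bochner_integral ::
    "'b measure \<Rightarrow> ('b \<Rightarrow> 'a::real_normed_vector) \<Rightarrow> 'a \<Rightarrow> bool"
  where "has_strong_bochner_integral M f I \<longleftrightarrow>
    strongly_measurable M f \<and>
    (\<exists>s. (\<forall>i::nat. Bochner_Integration.simple_bochner_integrable M (s i)) \<and>
         (\<lambda>i. \<integral>\<^sup>+x. norm (f x - s i x) \<partial>M) \<longlonglongrightarrow> 0 \<and>
         (\<lambda>i. Bochner_Integration.simple_bochner_integral M (s i)) \<longlonglongrightarrow> I)"

definition strong_bochner_integrable ::
    "'b measure \<Rightarrow> ('b \<Rightarrow> 'a::real_normed_vector) \<Rightarrow> bool"
  where "strong_bochner_integrable M f \<longleftrightarrow> (\<exists>I. has_strong_bochner_integral M f I)"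

definition strong_bochner_integral ::
    "'b measure \<Rightarrow> ('b \<Rightarrow> 'a::real_normed_vector) \<Rightarrow> 'a"
  where "strong_bochner_integral M f =
    (if strong_bochner_integrable M f then THE I. has_strong_bochner_integral M f I else 0)"

lemma strongly_measurable_norm_diff:
  fixes f :: "'b \<Rightarrow> 'a::real_normed_vector"
  assumes f: "strongly_measurable M f" and s: "simple_function M s"
  obtains g where "g \<in> borel_measurable M" "AE x in M. norm (f x - s x) = g x"
proof -
  obtain u where u: "\<And>i::nat. simple_function M (u i)" and lim: "AE x in M. (\<lambda>i. u i x) \<longlonglongrightarrow> f x"
    using f unfolding strongly_measurable_def by blast
  have sf: "simple_function M (\<lambda>x. norm (u i x - s x))" for i
    using simple_function_compose2[OF u s, of "\<lambda>a b. norm (a - b)"] .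
  have m: "(\<lambda>x. norm (u i x - s x)) \<in> borel_measurable M" for i
    using borel_measurable_simple_function[OF sf] .
  have "(\<lambda>x. lim (\<lambda>i. norm (u i x - s x))) \<in> borel_measurable M"
    by (rule borel_measurable_lim_metric) (rule m)
  moreover have "AE x in M. norm (f x - s x) = lim (\<lambda>i. norm (u i x - s x))"
    using lim
  proof eventually_elim
    case (elim x)
    have "(\<lambda>i. norm (u i x - s x)) \<longlonglongrightarrow> norm (f x - s x)"
      by (intro tendsto_intros elim)
    then show ?case by (simp add: limI)
  qed
  ultimately show ?thesis using that by blast
qed

lemma has_strong_bochner_integral_unique:
  fixes f :: "'b \<Rightarrow> 'a::real_normed_vector"
  assumes I: "has_strong_bochner_integral M f I" and J: "has_strong_bochner_integral M f J"
  shows "I = J"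
proof -
  let ?S = "Bochner_Integration.simple_bochner_integral M"
  have f: "strongly_measurable M f" using I by (simp add: has_strong_bochner_integral_def)
  obtain s where s: "\<And>i::nat. Bochner_Integration.simple_bochner_integrable M (s i)"
    and s0: "(\<lambda>i. \<integral>\<^sup>+x. norm (f x - s i x) \<partial>M) \<longlonglongrightarrow> 0"
    and sI: "(\<lambda>i. ?S (s i)) \<longlonglongrightarrow> I"
    using I unfolding has_strong_bochner_integral_def by blast
  obtain t where t: "\<And>i::nat. Bochner_Integration.simple_bochner_integrable M (t i)"
    and t0: "(\<lambda>i. \<integral>\<^sup>+x. norm (f x - t i x) \<partial>M) \<longlonglongrightarrow> 0"
    and tJ: "(\<lambda>i. ?S (t i)) \<longlonglongrightarrow> J"
    using J unfolding has_strong_bochner_integral_def by blast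
  have bound: "ennreal (norm (?S (s i) - ?S (t i)))
      \<le> (\<integral>\<^sup>+x. norm (f x - s i x) \<partial>M) + (\<integral>\<^sup>+x. norm (f x - t i x) \<partial>M)" for i
  proof -
    have ss: "simple_function M (s i)" and st: "simple_function M (t i)"
      using s t by (auto elim: simple_bochner_integrable.cases)
    have d: "Bochner_Integration.simple_bochner_integrable M (\<lambda>x. s i x - t i x)"
      by (rule simple_bochner_integrable_compose2) (auto intro: s t)
    have dn: "Bochner_Integration.simple_bochner_integrable M (\<lambda>x. norm (s i x - t i x))"
      using simple_bochner_integrable_compose2[OF _ s t, of "\<lambda>a b. norm (a - b)"] by simp
    obtain g where g: "g \<in> borel_measurable M" "AE x in M. norm (f x - s i x) = g x"
      using strongly_measurable_norm_diff[OF f ss] .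
    obtain h where h: "h \<in> borel_measurable M" "AE x in M. norm (f x - t i x) = h x"
      using strongly_measurable_norm_diff[OF f st] .
    have "ennreal (norm (?S (s i) - ?S (t i)))
        = norm (?S (\<lambda>x. s i x - t i x))"
      by (simp add: simple_bochner_integral_diff s t)
    also have "\<dots> \<le> ?S (\<lambda>x. norm (s i x - t i x))"
      by (intro ennreal_leI simple_bochner_integral_norm_bound d)
    also have "\<dots> = (\<integral>\<^sup>+x. norm (s i x - t i x) \<partial>M)"
      by (intro simple_bochner_integral_eq_nn_integral dn) simp
    also have "\<dots> \<le> (\<integral>\<^sup>+x. ennreal (g x) + ennreal (h x) \<partial>M)"
    proof (rule nn_integral_mono_AE)
      show "AE x in M. ennreal (norm (s i x - t i x)) \<le> ennreal (g x) + ennreal (h x)"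
        using g(2) h(2)
      proof eventually_elim
        case (elim x)
        have "norm (s i x - t i x) \<le> norm (f x - s i x) + norm (f x - t i x)"
          by (metis dist_norm dist_triangle2 norm_minus_commute)
        then show ?case
          using elim by (metis ennreal_leI ennreal_plus norm_ge_zero)
      qed
    qed
    also have "\<dots> = (\<integral>\<^sup>+x. ennreal (g x) \<partial>M) + (\<integral>\<^sup>+x. ennreal (h x) \<partial>M)"
      by (intro nn_integral_add) (use g(1) h(1) in measurable)
    also have "(\<integral>\<^sup>+x. ennreal (g x) \<partial>M) = (\<integral>\<^sup>+x. norm (f x - s i x) \<partial>M)"
      using g(2) by (intro nn_integral_cong_AE) auto
    also have "(\<integral>\<^sup>+x. ennreal (h x) \<partial>M) = (\<integral>\<^sup>+x. norm (f x - t i x) \<partial>M)"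
      using h(2) by (intro nn_integral_cong_AE) auto
    finally show ?thesis .
  qed
  have "(\<lambda>i. (\<integral>\<^sup>+x. norm (f x - s i x) \<partial>M) + (\<integral>\<^sup>+x. norm (f x - t i x) \<partial>M)) \<longlonglongrightarrow> 0"
    using tendsto_add[OF s0 t0] by simp
  then have "(\<lambda>i. ennreal (norm (?S (s i) - ?S (t i)))) \<longlonglongrightarrow> 0"
    by (rule tendsto_sandwich[OF _ _ tendsto_const, rotated 2]) (simp_all add: bound)
  then have "(\<lambda>i. norm (?S (s i) - ?S (t i))) \<longlonglongrightarrow> 0"
    by (simp add: tendsto_ennreal_iff[where x = 0, simplified])
  moreover have "(\<lambda>i. norm (?S (s i) - ?S (t i)))
      \<longlonglongrightarrow> norm (I - J)"
    by (intro tendsto_intros sI tJ)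
  ultimately have "norm (I - J) = 0"
    using LIMSEQ_unique by blast
  then show ?thesis by simp
qed

lemma strong_bochner_integral_eq:
  "has_strong_bochner_integral M f I \<Longrightarrow> strong_bochner_integral M f = I"
  unfolding strong_bochner_integral_def strong_bochner_integrable_def
  by (auto intro: the_equality dest: has_strong_bochner_integral_unique)

lemma has_bochner_integral_imp_strong:
  fixes f :: "'b \<Rightarrow> 'a::{real_normed_vector, second_countable_topology}"
  assumes "has_bochner_integral M f I"
  shows "has_strong_bochner_integral M f I"
  using assms
proof cases
  case (1 s)
  obtain F where "\<And>i. simple_function M (F i)" "\<And>x. x \<in> space M \<Longrightarrow> (\<lambda>i. F i x) \<longlonglongrightarrow> f x"
    using borel_measurable_implies_sequence_metric[OF 1(1), of 0] by blast
  then have "strongly_measurable M f"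
    unfolding strongly_measurable_def by (intro exI[of _ F]) auto
  with 1 show ?thesis
    unfolding has_strong_bochner_integral_def by blast
qed


text \<open>The spaces are spaces of representatives; functions that agree almost everywhere have
  distance \<open>0\<close> in the seminorm.\<close>

definition Lq :: "real \<Rightarrow> 'b measure \<Rightarrow> ('b \<Rightarrow> 'a::real_normed_vector) set"
  where "Lq q M = {g. strongly_measurable M g \<and> integrable M (\<lambda>x. norm (g x) powr q)}"

definition Lq_norm :: "real \<Rightarrow> 'b measure \<Rightarrow> ('b \<Rightarrow> 'a::real_normed_vector) \<Rightarrow> real"
  where "Lq_norm q M g = (\<integral>x. norm (g x) powr q \<partial>M) powr (1 / q)"

definition Lq_loc :: "real \<Rightarrow> (real \<Rightarrow> 'a::real_normed_vector) set"
  where "Lq_loc q = {f. \<forall>T\<ge>0. f \<in> Lq q (lebesgue_on {0..T})}"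


text \<open>A function on \<open>[0,\<infinity>)\<close> is a function on the reals of which only the values at \<open>t \<ge> 0\<close>
  matter.\<close>

definition AAP :: "(real \<Rightarrow> 'z::real_normed_vector) set"
  where "AAP = {u. bounded (u ` {0..}) \<and> continuous_on {0..} u \<and>
    (\<forall>\<epsilon>>0. \<exists>l>0. \<exists>M>0. \<forall>a\<ge>0. \<exists>\<tau>\<in>{a..a + l}. \<forall>t\<ge>M. norm (u (t + \<tau>) - u t) \<le> \<epsilon>)}"

text \<open>The same notion for functions with values in a space \<open>Z\<close> whose norm \<open>N\<close> is not the norm of
  a type class.  It is needed for \<open>Z = L\<^sup>q\<close>, which is not a type because it depends on \<open>q\<close>.\<close>

definition AAP_in :: "'z::minus set \<Rightarrow> ('z \<Rightarrow> real) \<Rightarrow> (real \<Rightarrow> 'z) set"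
  where "AAP_in Z N = {u. (\<forall>t\<ge>0. u t \<in> Z) \<and> (\<exists>C. \<forall>t\<ge>0. N (u t) \<le> C) \<and>
    (\<forall>t\<ge>0. ((\<lambda>s. N (u s - u t)) \<longlongrightarrow> 0) (at t within {0..})) \<and>
    (\<forall>\<epsilon>>0. \<exists>l>0. \<exists>M>0. \<forall>a\<ge>0. \<exists>\<tau>\<in>{a..a + l}. \<forall>t\<ge>M. N (u (t + \<tau>) - u t) \<le> \<epsilon>)}"

lemma AAP_eq_AAP_in: "AAP = AAP_in UNIV norm"
proof -
  have "bounded (u ` {0..}) \<longleftrightarrow> (\<exists>C. \<forall>t\<ge>0. norm (u t) \<le> C)" for u :: "real \<Rightarrow> 'a"
    by (auto simp: bounded_iff)
  moreover have "continuous_on {0..} u \<longleftrightarrow>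
      (\<forall>t\<ge>0. ((\<lambda>s. norm (u s - u t)) \<longlongrightarrow> 0) (at t within {0..}))" for u :: "real \<Rightarrow> 'a"
    by (simp add: continuous_on_def tendsto_norm_zero_iff LIM_zero_iff Ball_def)
  ultimately show ?thesis
    by (simp add: AAP_def AAP_in_def)
qed

definition AAPS :: "real \<Rightarrow> (real \<Rightarrow> 'a::real_normed_vector) set"
  where "AAPS q = {f. f \<in> Lq_loc q \<and>
    bdd_above ((\<lambda>t. (\<integral>s. norm (f s) powr q \<partial>lebesgue_on {t..t + 1}) powr (1 / q)) ` {0..}) \<and>
    (\<lambda>t x. f (t + x)) \<in> AAP_in (Lq q (lebesgue_on {0..1})) (Lq_norm q (lebesgue_on {0..1}))}"

end

theory Submission
  imports Defs
begin

text \<open>Extend \<open>f\<close> by \<open>0\<close> to the real line and translate \<open>H (t + \<tau>)\<close> by \<open>\<tau>\<close>; then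
  \<open>H (t + \<tau>) - H t\<close> is the integral over \<open>s < t\<close> of \<open>R (t - s) (f (\<tau> + s) - f s)\<close>.  After the
  exponential rate has been lowered, the norm of \<open>R\<close> is dominated by \<open>exp (- \<omega> s) s powr \<gamma>\<close> with
  \<open>\<gamma> \<le> 0\<close>.  On the unit interval \<open>t - j - 1 \<le> s < t - j\<close> this kernel is at most
  \<open>exp (- \<omega> j) (t - j - s) powr \<gamma>\<close>, so a local inequality of Hoelder type
  and a geometric series bound the difference by the local \<open>L\<^sup>q\<close> norms of \<open>f (\<tau> + s) - f s\<close>.
  These are bounded, small on bounded sets as \<open>\<tau>\<close> tends to \<open>0\<close>, and small far out if \<open>\<tau>\<close> is an
  almost period; this gives boundedness, continuity and asymptotic almost periodicity of \<open>H\<close>.\<close>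

section \<open>Strong Bochner integrals\<close>

text \<open>As \<open>X\<close> need not be separable, strong measurability has to carry the
  argument. Completeness of Lebesgue measure makes the norms of strongly measurable functions
  measurable, so all estimates can be made with nonnegative integrals of real functions. The rate is
  lowered because for \<beta> > 1 the kernel is not monotone: half of \<omega> pays for the growing
  power, and what remains is decreasing. The condition on \<open>q'\<close> is integrability at 0 of
  the power into which the Hoelder-type inequality turns the singularity; the free small \<eta> in
  that inequality lets it cover \<open>q = 1\<close> as well. The obstacle at the end is that an
  almost period of \<open>f\<close> controls differences only beyond some \<open>M\<close>, while
  \<open>H\<close> looks back to time 0. On the early intervals the local norms are merely bounded,
  and the decay of the kernel over the distance back to them must make up for that.\<close>

lemma strongly_measurable_diff:
  fixes f g :: "'b \<Rightarrow> 'a::real_normed_vector"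
  assumes "strongly_measurable M f" "strongly_measurable M g"
  shows "strongly_measurable M (\<lambda>x. f x - g x)"
proof -
  obtain s where s: "\<And>i::nat. simple_function M (s i)" "AE x in M. (\<lambda>i. s i x) \<longlonglongrightarrow> f x"
    using assms(1) unfolding strongly_measurable_def by blast
  obtain t where t: "\<And>i::nat. simple_function M (t i)" "AE x in M. (\<lambda>i. t i x) \<longlonglongrightarrow> g x"
    using assms(2) unfolding strongly_measurable_def by blast
  show ?thesis
    unfolding strongly_measurable_def
  proof (intro exI[of _ "\<lambda>i x. s i x - t i x"] conjI allI)
    show "simple_function M (\<lambda>x. s i x - t i x)" for i
      using simple_function_compose2[OF s(1) t(1)] .
    show "AE x in M. (\<lambda>i. s i x - t i x) \<longlonglongrightarrow> f x - g x"
      using s(2) t(2) by eventually_elim (rule tendsto_diff)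
  qed
qed

lemma strongly_measurable_norm:
  fixes f :: "'b \<Rightarrow> 'a::real_normed_vector"
  assumes "strongly_measurable M f"
  obtains g where "g \<in> borel_measurable M" "AE x in M. norm (f x) = g x"
  using strongly_measurable_norm_diff[OF assms, of "\<lambda>_. 0"] by auto

text \<open>The norm agrees almost everywhere with a measurable function, and in a complete space a
  set that differs from a measurable one by a null set is measurable.\<close>

lemma (in complete_measure) borel_measurable_norm_strongly:
  fixes f :: "'a \<Rightarrow> 'c::real_normed_vector"
  assumes "strongly_measurable M f"
  shows "(\<lambda>x. norm (f x)) \<in> borel_measurable M"
proof -
  obtain g where g: "g \<in> borel_measurable M" "AE x in M. norm (f x) = g x"
    using strongly_measurable_norm[OF assms] .
  show ?thesis
  proof (rule measurableI)
    fix A :: "real set" assume "A \<in> sets borel"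
    then have "g -` A \<inter> space M \<in> sets M"
      using g(1) by (rule measurable_sets[rotated])
    then show "(\<lambda>x. norm (f x)) -` A \<inter> space M \<in> sets M"
      by (rule in_sets_AE[rotated]) (use g(2) in auto)
  qed simp
qed

text \<open>The triangle inequality through \<open>f\<close> and \<open>g\<close>. It has two uses:
  with different \<open>f\<close> and \<open>g\<close> it compares their integrals in the limit, and
  with \<open>f = g\<close> it is the Cauchy estimate behind existence.\<close>

lemma simple_bochner_integral_dist_le:
  fixes f g :: "'b \<Rightarrow> 'a::real_normed_vector"
  assumes f: "strongly_measurable M f" and g: "strongly_measurable M g"
    and s: "Bochner_Integration.simple_bochner_integrable M s"
    and t: "Bochner_Integration.simple_bochner_integrable M t"
  shows "ennreal (norm (Bochner_Integration.simple_bochner_integral M s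
            - Bochner_Integration.simple_bochner_integral M t))
      \<le> (\<integral>\<^sup>+x. norm (f x - s x) \<partial>M) + (\<integral>\<^sup>+x. norm (f x - g x) \<partial>M) + (\<integral>\<^sup>+x. norm (g x - t x) \<partial>M)"
proof -
  let ?S = "Bochner_Integration.simple_bochner_integral M"
  have ss: "simple_function M s" and st: "simple_function M t"
    using s t by (auto elim: simple_bochner_integrable.cases)
  have d: "Bochner_Integration.simple_bochner_integrable M (\<lambda>x. s x - t x)"
    by (rule simple_bochner_integrable_compose2) (auto intro: s t)
  have dn: "Bochner_Integration.simple_bochner_integrable M (\<lambda>x. norm (s x - t x))"
    using simple_bochner_integrable_compose2[OF _ s t, of "\<lambda>a b. norm (a - b)"] by simp
  \<comment> \<open>The distances themselves need not be measurable when \<open>M\<close> is not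
    complete; additivity of the integral is applied to measurable versions of them.\<close>
  obtain u where u: "u \<in> borel_measurable M" "AE x in M. norm (f x - s x) = u x"
    using strongly_measurable_norm_diff[OF f ss] .
  obtain v where v: "v \<in> borel_measurable M" "AE x in M. norm (f x - g x) = v x"
    using strongly_measurable_norm[OF strongly_measurable_diff[OF f g]] .
  obtain w where w: "w \<in> borel_measurable M" "AE x in M. norm (g x - t x) = w x"
    using strongly_measurable_norm_diff[OF g st] .
  have "ennreal (norm (?S s - ?S t)) = norm (?S (\<lambda>x. s x - t x))"
    by (simp add: simple_bochner_integral_diff s t)
  also have "\<dots> \<le> ?S (\<lambda>x. norm (s x - t x))"
    by (intro ennreal_leI simple_bochner_integral_norm_bound d)
  also have "\<dots> = (\<integral>\<^sup>+x. norm (s x - t x) \<partial>M)"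
    by (intro simple_bochner_integral_eq_nn_integral dn) simp
  also have "\<dots> \<le> (\<integral>\<^sup>+x. ennreal (u x) + ennreal (v x) + ennreal (w x) \<partial>M)"
  proof (rule nn_integral_mono_AE)
    show "AE x in M. ennreal (norm (s x - t x)) \<le> ennreal (u x) + ennreal (v x) + ennreal (w x)"
      using u(2) v(2) w(2)
    proof eventually_elim
      case (elim x)
      have "norm (s x - t x) \<le> norm (f x - s x) + norm (f x - g x) + norm (g x - t x)"
        using norm_triangle_ineq4[of "(f x - g x) + (g x - t x)" "f x - s x"]
          norm_triangle_ineq[of "f x - g x" "g x - t x"] by simp
      then have "ennreal (norm (s x - t x)) \<le> ennreal (norm (f x - s x) + norm (f x - g x) + norm (g x - t x))"
        by (rule ennreal_leI)
      also have "\<dots> = ennreal (u x) + ennreal (v x) + ennreal (w x)"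
        unfolding elim[symmetric] by (simp add: ennreal_plus)
      finally show ?case .
    qed
  qed
  also have "\<dots> = (\<integral>\<^sup>+x. ennreal (u x) \<partial>M) + (\<integral>\<^sup>+x. ennreal (v x) \<partial>M) + (\<integral>\<^sup>+x. ennreal (w x) \<partial>M)"
    using u(1) v(1) w(1) by (simp add: nn_integral_add)
  also have "(\<integral>\<^sup>+x. ennreal (u x) \<partial>M) = (\<integral>\<^sup>+x. norm (f x - s x) \<partial>M)"
    using u(2) by (intro nn_integral_cong_AE) auto
  also have "(\<integral>\<^sup>+x. ennreal (v x) \<partial>M) = (\<integral>\<^sup>+x. norm (f x - g x) \<partial>M)"
    using v(2) by (intro nn_integral_cong_AE) auto
  also have "(\<integral>\<^sup>+x. ennreal (w x) \<partial>M) = (\<integral>\<^sup>+x. norm (g x - t x) \<partial>M)"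
    using w(2) by (intro nn_integral_cong_AE) auto
  finally show ?thesis .
qed

text \<open>The limit of the preceding estimate along approximating sequences of both functions. All
  later estimates of \<open>H\<close> go through it.\<close>

lemma has_strong_bochner_integral_dist_le:
  fixes f g :: "'b \<Rightarrow> 'a::real_normed_vector"
  assumes I: "has_strong_bochner_integral M f I" and J: "has_strong_bochner_integral M g J"
  shows "ennreal (norm (I - J)) \<le> (\<integral>\<^sup>+x. norm (f x - g x) \<partial>M)"
proof -
  let ?S = "Bochner_Integration.simple_bochner_integral M"
  obtain s where s: "\<And>i::nat. Bochner_Integration.simple_bochner_integrable M (s i)"
    and s0: "(\<lambda>i. \<integral>\<^sup>+x. norm (f x - s i x) \<partial>M) \<longlonglongrightarrow> 0"
    and sI: "(\<lambda>i. ?S (s i)) \<longlonglongrightarrow> I"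
    using I unfolding has_strong_bochner_integral_def by blast
  obtain t where t: "\<And>i::nat. Bochner_Integration.simple_bochner_integrable M (t i)"
    and t0: "(\<lambda>i. \<integral>\<^sup>+x. norm (g x - t i x) \<partial>M) \<longlonglongrightarrow> 0"
    and tJ: "(\<lambda>i. ?S (t i)) \<longlonglongrightarrow> J"
    using J unfolding has_strong_bochner_integral_def by blast
  have "(\<lambda>i. ennreal (norm (?S (s i) - ?S (t i)))) \<longlonglongrightarrow> ennreal (norm (I - J))"
    by (intro tendsto_intros sI tJ tendsto_ennrealI)
  moreover have "(\<lambda>i. (\<integral>\<^sup>+x. norm (f x - s i x) \<partial>M) + (\<integral>\<^sup>+x. norm (f x - g x) \<partial>M)
      + (\<integral>\<^sup>+x. norm (g x - t i x) \<partial>M)) \<longlonglongrightarrow> 0 + (\<integral>\<^sup>+x. norm (f x - g x) \<partial>M) + 0"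
    by (intro tendsto_intros s0 t0)
  ultimately have "ennreal (norm (I - J)) \<le> 0 + (\<integral>\<^sup>+x. norm (f x - g x) \<partial>M) + 0"
    using simple_bochner_integral_dist_le[OF _ _ s t] I J
    unfolding has_strong_bochner_integral_def by (blast intro: LIMSEQ_le)
  then show ?thesis by simp
qed

text \<open>Strong measurability gives simple functions that converge only almost everywhere.
  Truncated, they converge in mean by dominated convergence; their integrals are then Cauchy, and
  completeness of the space supplies the limit.\<close>

lemma strong_bochner_integrableI:
  fixes f :: "'b \<Rightarrow> 'a::banach"
  assumes f: "strongly_measurable M f" and fin: "(\<integral>\<^sup>+x. norm (f x) \<partial>M) < \<infinity>"
  shows "strong_bochner_integrable M f"
proof -
  let ?S = "Bochner_Integration.simple_bochner_integral M"
  obtain s where s: "\<And>i::nat. simple_function M (s i)" "AE x in M. (\<lambda>i. s i x) \<longlonglongrightarrow> f x"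
    using f unfolding strongly_measurable_def by blast
  obtain g where g[measurable]: "g \<in> borel_measurable M" and gf: "AE x in M. norm (f x) = g x"
    using strongly_measurable_norm[OF f] .
  have gfin: "(\<integral>\<^sup>+x. ennreal (g x) \<partial>M) < \<infinity>"
  proof -
    have "(\<integral>\<^sup>+x. ennreal (g x) \<partial>M) = (\<integral>\<^sup>+x. norm (f x) \<partial>M)"
      using gf by (intro nn_integral_cong_AE) auto
    then show ?thesis using fin by simp
  qed
  have [measurable]: "(\<lambda>x. norm (s i x)) \<in> borel_measurable M" for i
    by (rule borel_measurable_simple_function) (rule simple_function_compose1[OF s(1)])
  define A where "A i = {x \<in> space M. norm (s i x) \<le> 2 * g x}" for i
  have A[measurable]: "A i \<in> sets M" for i
    unfolding A_def by measurable
  \<comment> \<open>The truncation makes \<open>g\<close> dominate the approximating simple functions.\<close>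
  define r where "r i x = (if x \<in> A i then s i x else 0)" for i x
  have r: "simple_function M (r i)" for i
    unfolding r_def using A s(1) by (intro simple_function_If_set) auto
  have rb: "AE x in M. norm (r i x) \<le> 2 * g x" for i
    using gf
  proof eventually_elim
    case (elim x)
    have "0 \<le> g x" using elim norm_ge_zero by metis
    then show ?case by (auto simp: r_def A_def)
  qed
  have lim: "AE x in M. (\<lambda>i. norm (f x - r i x)) \<longlonglongrightarrow> 0"
    using gf s(2) AE_space
  proof eventually_elim
    case (elim x)
    show ?case
    proof (cases "f x = 0")
      case True
      \<comment> \<open>Where \<open>f\<close> vanishes, so does \<open>g\<close>, and membership in
        \<open>A i\<close> already forces \<open>s i x = 0\<close>.\<close>
      then have "r i x = 0" for i
        using elim by (auto simp: r_def A_def)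
      then show ?thesis using True by simp
    next
      case False
      have "(\<lambda>i. norm (s i x)) \<longlonglongrightarrow> norm (f x)"
        by (intro tendsto_norm elim)
      \<comment> \<open>The factor 2 in \<open>A\<close> leaves room: as \<open>f x\<close> is not
        0, the truncation is eventually inactive.\<close>
      then have "\<forall>\<^sub>F i in sequentially. norm (s i x) < 2 * norm (f x)"
        by (rule order_tendstoD) (use False in simp)
      then have "\<forall>\<^sub>F i in sequentially. s i x = r i x"
        by eventually_elim (use elim in \<open>auto simp: r_def A_def\<close>)
      then have "(\<lambda>i. r i x) \<longlonglongrightarrow> f x"
        using elim(2) by (rule Lim_transform_eventually[rotated])
      then have "(\<lambda>i. norm (f x - r i x)) \<longlonglongrightarrow> norm (f x - f x)"
        by (intro tendsto_intros)
      then show ?thesis by simp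
    qed
  qed
  have rint: "Bochner_Integration.simple_bochner_integrable M (r i)" for i
  proof (rule simple_bochner_integrableI_bounded[OF r])
    have "(\<integral>\<^sup>+x. norm (r i x) \<partial>M) \<le> (\<integral>\<^sup>+x. 2 * ennreal (g x) \<partial>M)"
      by (rule nn_integral_mono_AE, use rb[of i] in eventually_elim)
        (metis ennreal_leI ennreal_mult' ennreal_numeral zero_le_numeral)
    also have "\<dots> < \<infinity>"
      using gfin by (simp add: nn_integral_cmult ennreal_mult_less_top)
    finally show "(\<integral>\<^sup>+x. norm (r i x) \<partial>M) < \<infinity>" .
  qed
  have "\<exists>h. h \<in> borel_measurable M \<and> (AE x in M. norm (f x - r i x) = h x)" for i
    using strongly_measurable_norm_diff[OF f r] by metis
  then obtain h where h: "\<And>i. h i \<in> borel_measurable M"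
      "\<And>i. AE x in M. norm (f x - r i x) = h i x"
    by metis
  have "(\<lambda>i. \<integral>\<^sup>+x. h i x \<partial>M) \<longlonglongrightarrow> (\<integral>\<^sup>+x. 0 \<partial>M)"
  proof (rule nn_integral_dominated_convergence[where w="\<lambda>x. 3 * ennreal (g x)"])
    show "(\<integral>\<^sup>+x. 3 * ennreal (g x) \<partial>M) < \<infinity>"
      using gfin by (simp add: nn_integral_cmult ennreal_mult_less_top)
    show "AE x in M. ennreal (h i x) \<le> 3 * ennreal (g x)" for i
      using rb[of i] gf h(2)[of i]
    proof eventually_elim
      case (elim x)
      have "h i x \<le> 3 * g x"
        using norm_triangle_ineq4[of "f x" "r i x"] elim by linarith
      then show ?case
        by (metis ennreal_leI ennreal_mult' ennreal_numeral zero_le_numeral)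
    qed
    have "AE x in M. \<forall>i. norm (f x - r i x) = h i x"
      using h(2) by (simp add: AE_all_countable)
    then show "AE x in M. (\<lambda>i. ennreal (h i x)) \<longlonglongrightarrow> 0"
      using lim
    proof eventually_elim
      case (elim x)
      have "(\<lambda>i. ennreal (norm (f x - r i x))) \<longlonglongrightarrow> ennreal 0"
        by (rule tendsto_ennrealI[OF elim(2)])
      then show ?case using elim(1) by simp
    qed
  qed (use h in measurable)
  moreover have "(\<integral>\<^sup>+x. h i x \<partial>M) = (\<integral>\<^sup>+x. norm (f x - r i x) \<partial>M)" for i
    using h(2)[of i] by (intro nn_integral_cong_AE) auto
  ultimately have e: "(\<lambda>i. \<integral>\<^sup>+x. norm (f x - r i x) \<partial>M) \<longlonglongrightarrow> 0"
    by simp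
  have "Cauchy (\<lambda>i. ?S (r i))"
  proof (rule metric_CauchyI)
    fix \<epsilon> :: real assume "\<epsilon> > 0"
    then have "\<forall>\<^sub>F i in sequentially. (\<integral>\<^sup>+x. norm (f x - r i x) \<partial>M) < ennreal (\<epsilon> / 2)"
      by (intro order_tendstoD[OF e]) simp
    then obtain N where N: "\<And>i. i \<ge> N \<Longrightarrow> (\<integral>\<^sup>+x. norm (f x - r i x) \<partial>M) < ennreal (\<epsilon> / 2)"
      by (auto simp: eventually_sequentially)
    show "\<exists>N. \<forall>m\<ge>N. \<forall>n\<ge>N. dist (?S (r m)) (?S (r n)) < \<epsilon>"
    proof (intro exI allI impI)
      fix m n assume "N \<le> m" "N \<le> n"
      have "ennreal (norm (?S (r m) - ?S (r n)))
          \<le> (\<integral>\<^sup>+x. norm (f x - r m x) \<partial>M) + (\<integral>\<^sup>+x. norm (f x - r n x) \<partial>M)"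
        using simple_bochner_integral_dist_le[OF f f rint rint] by simp
      also have "\<dots> < ennreal (\<epsilon> / 2) + ennreal (\<epsilon> / 2)"
        by (intro add_strict_mono N \<open>N \<le> m\<close> \<open>N \<le> n\<close>)
      also have "\<dots> = ennreal \<epsilon>"
        using \<open>\<epsilon> > 0\<close> by (simp flip: ennreal_plus)
      finally show "dist (?S (r m)) (?S (r n)) < \<epsilon>"
        using \<open>\<epsilon> > 0\<close> by (simp add: dist_norm ennreal_less_iff)
    qed
  qed
  then obtain I where "(\<lambda>i. ?S (r i)) \<longlonglongrightarrow> I"
    using Cauchy_convergent_iff convergent_def by blast
  then show ?thesis
    unfolding strong_bochner_integrable_def has_strong_bochner_integral_def
    using f rint e by blast
qed

section \<open>Restriction of the domain and measure-preserving substitution\<close>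

lemma strongly_measurable_restrict_space:
  fixes f :: "'b \<Rightarrow> 'a::real_normed_vector"
  assumes \<Omega>: "\<Omega> \<in> sets M" and f: "strongly_measurable (restrict_space M \<Omega>) f"
  shows "strongly_measurable M (\<lambda>x. indicator \<Omega> x *\<^sub>R f x)"
proof -
  have \<Omega>': "\<Omega> \<inter> space M \<in> sets M" using \<Omega> by simp
  obtain s where s: "\<And>i::nat. simple_function (restrict_space M \<Omega>) (s i)"
      "AE x in restrict_space M \<Omega>. (\<lambda>i. s i x) \<longlonglongrightarrow> f x"
    using f unfolding strongly_measurable_def by blast
  show ?thesis
    unfolding strongly_measurable_def
  proof (intro exI[of _ "\<lambda>i x. indicator \<Omega> x *\<^sub>R s i x"] conjI allI)
    show "simple_function M (\<lambda>x. indicator \<Omega> x *\<^sub>R s i x)" for i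
      using s(1) simple_function_restrict_space[OF \<Omega>'] by blast
    have "AE x in M. x \<in> \<Omega> \<longrightarrow> (\<lambda>i. s i x) \<longlonglongrightarrow> f x"
      using s(2) by (simp add: AE_restrict_space_iff[OF \<Omega>'])
    then show "AE x in M. (\<lambda>i. indicator \<Omega> x *\<^sub>R s i x) \<longlonglongrightarrow> indicator \<Omega> x *\<^sub>R f x"
      by eventually_elim (auto simp: indicator_def)
  qed
qed

text \<open>Puts the integrals over \<open>{0..t}\<close> for different \<open>t\<close> on one
  measure space, where they can be translated and compared.\<close>

lemma has_strong_bochner_integral_restrict_space:
  fixes f :: "'b \<Rightarrow> 'a::real_normed_vector"
  assumes \<Omega>: "\<Omega> \<in> sets M" and f: "has_strong_bochner_integral (restrict_space M \<Omega>) f I"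
  shows "has_strong_bochner_integral M (\<lambda>x. indicator \<Omega> x *\<^sub>R f x) I"
proof -
  let ?R = "restrict_space M \<Omega>"
  have \<Omega>': "\<Omega> \<inter> space M \<in> sets M" using \<Omega> by simp
  obtain s where s: "\<And>i::nat. Bochner_Integration.simple_bochner_integrable ?R (s i)"
    and s0: "(\<lambda>i. \<integral>\<^sup>+x. norm (f x - s i x) \<partial>?R) \<longlonglongrightarrow> 0"
    and sI: "(\<lambda>i. Bochner_Integration.simple_bochner_integral ?R (s i)) \<longlonglongrightarrow> I"
    using f unfolding has_strong_bochner_integral_def by blast
  have "(\<integral>\<^sup>+x. norm (f x - s i x) \<partial>?R)
      = (\<integral>\<^sup>+x. norm (indicator \<Omega> x *\<^sub>R f x - indicator \<Omega> x *\<^sub>R s i x) \<partial>M)" for i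
    unfolding nn_integral_restrict_space[OF \<Omega>']
    by (intro nn_integral_cong) (auto simp: indicator_def)
  moreover have "Bochner_Integration.simple_bochner_integrable M (\<lambda>x. indicator \<Omega> x *\<^sub>R s i x)" for i
    using s simple_bochner_integrable_restrict_space[OF \<Omega>'] by blast
  moreover have "Bochner_Integration.simple_bochner_integral ?R (s i)
      = Bochner_Integration.simple_bochner_integral M (\<lambda>x. indicator \<Omega> x *\<^sub>R s i x)" for i
    by (rule simple_bochner_integral_restrict_space[OF \<Omega>' s])
  ultimately show ?thesis
    using strongly_measurable_restrict_space[OF \<Omega>, of f] f s0 sI
    unfolding has_strong_bochner_integral_def
    by (intro conjI exI[of _ "\<lambda>i x. indicator \<Omega> x *\<^sub>R s i x"]) auto
qed

text \<open>The hypothesis on \<open>distr\<close> says that \<open>T\<close> preserves measure;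
  hence preimages of null sets are null, and convergence almost everywhere can be pulled
  back.\<close>

lemma strongly_measurable_comp:
  fixes f :: "'b \<Rightarrow> 'a::real_normed_vector"
  assumes T: "T \<in> measurable M N" and d: "distr M N T = N" and f: "strongly_measurable N f"
  shows "strongly_measurable M (\<lambda>x. f (T x))"
proof -
  obtain s where s: "\<And>i::nat. simple_function N (s i)" "AE x in N. (\<lambda>i. s i x) \<longlonglongrightarrow> f x"
    using f unfolding strongly_measurable_def by blast
  have "AE x in distr M N T. (\<lambda>i. s i x) \<longlonglongrightarrow> f x"
    unfolding d by (rule s(2))
  from AE_distrD[OF T this] show ?thesis
    unfolding strongly_measurable_def using s(1)
    by (intro exI[of _ "\<lambda>i x. s i (T x)"]) (auto intro!: simple_function_comp[OF T])
qed

lemma simple_bochner_integral_comp: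
  fixes s :: "'b \<Rightarrow> 'a::real_normed_vector"
  assumes T: "T \<in> measurable M N" and d: "distr M N T = N"
    and s: "Bochner_Integration.simple_bochner_integrable N s"
  shows "Bochner_Integration.simple_bochner_integrable M (\<lambda>x. s (T x))"
    and "Bochner_Integration.simple_bochner_integral M (\<lambda>x. s (T x))
      = Bochner_Integration.simple_bochner_integral N s"
proof -
  have sf: "simple_function N s" and fin: "emeasure N {y \<in> space N. s y \<noteq> 0} \<noteq> \<infinity>"
    using s by (auto elim: simple_bochner_integrable.cases)
  have pre: "{x \<in> space M. P (s (T x))} = T -` {y \<in> space N. P (s y)} \<inter> space M" for P
    using measurable_space[OF T] by auto
  have sets: "{y \<in> space N. P (s y)} \<in> sets N" for P
    using simple_functionD(2)[OF sf, of "Collect P"] by (simp add: vimage_def Int_def conj_commute)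
  show "Bochner_Integration.simple_bochner_integrable M (\<lambda>x. s (T x))"
  proof
    show "simple_function M (\<lambda>x. s (T x))"
      by (rule simple_function_comp[OF T sf])
    have "emeasure M {x \<in> space M. s (T x) \<noteq> 0} = emeasure (distr M N T) {y \<in> space N. s y \<noteq> 0}"
      using pre[of "\<lambda>y. y \<noteq> 0"] emeasure_distr[OF T sets[of "\<lambda>y. y \<noteq> 0"]] by simp
    then show "emeasure M {x \<in> space M. s (T x) \<noteq> 0} \<noteq> \<infinity>"
      using fin by (simp add: d)
  qed
  have m: "measure M {x \<in> space M. s (T x) = y} = measure N {x \<in> space N. s x = y}" for y
  proof -
    have "measure M {x \<in> space M. s (T x) = y} = measure (distr M N T) {x \<in> space N. s x = y}"
      using pre[of "\<lambda>z. z = y"] measure_distr[OF T sets[of "\<lambda>z. z = y"]] by simp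
    then show ?thesis by (simp add: d)
  qed
  \<comment> \<open>\<open>T\<close> need not be onto, so \<open>s\<close> may take values that the
    composition misses; their level sets in \<open>M\<close> are empty and contribute 0.\<close>
  have "(\<Sum>y\<in>(\<lambda>x. s (T x)) ` space M. measure M {x \<in> space M. s (T x) = y} *\<^sub>R y)
      = (\<Sum>y\<in>s ` space N. measure M {x \<in> space M. s (T x) = y} *\<^sub>R y)"
  proof (rule sum.mono_neutral_left)
    show "finite (s ` space N)" using sf by (rule simple_functionD)
    show "(\<lambda>x. s (T x)) ` space M \<subseteq> s ` space N" using measurable_space[OF T] by auto
    show "\<forall>y\<in>s ` space N - (\<lambda>x. s (T x)) ` space M. measure M {x \<in> space M. s (T x) = y} *\<^sub>R y = 0"
    proof
      fix y assume "y \<in> s ` space N - (\<lambda>x. s (T x)) ` space M"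
      then have "{x \<in> space M. s (T x) = y} = {}" by (auto simp: image_iff)
      then have "measure M {x \<in> space M. s (T x) = y} = 0" by (metis measure_empty)
      then show "measure M {x \<in> space M. s (T x) = y} *\<^sub>R y = 0" by simp
    qed
  qed
  then show "Bochner_Integration.simple_bochner_integral M (\<lambda>x. s (T x))
      = Bochner_Integration.simple_bochner_integral N s"
    unfolding Bochner_Integration.simple_bochner_integral_def m .
qed

lemma has_strong_bochner_integral_comp:
  fixes f :: "'b \<Rightarrow> 'a::real_normed_vector"
  assumes T: "T \<in> measurable M N" and d: "distr M N T = N"
    and f: "has_strong_bochner_integral N f I"
  shows "has_strong_bochner_integral M (\<lambda>x. f (T x)) I"
proof -
  obtain s where s: "\<And>i::nat. Bochner_Integration.simple_bochner_integrable N (s i)"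
    and s0: "(\<lambda>i. \<integral>\<^sup>+x. norm (f x - s i x) \<partial>N) \<longlonglongrightarrow> 0"
    and sI: "(\<lambda>i. Bochner_Integration.simple_bochner_integral N (s i)) \<longlonglongrightarrow> I"
    using f unfolding has_strong_bochner_integral_def by blast
  have fm: "strongly_measurable N f"
    using f unfolding has_strong_bochner_integral_def by blast
  have "(\<integral>\<^sup>+x. norm (f (T x) - s i (T x)) \<partial>M) = (\<integral>\<^sup>+x. norm (f x - s i x) \<partial>N)" for i
  proof -
    have "simple_function N (s i)" using s by (auto elim: simple_bochner_integrable.cases)
    \<comment> \<open>The substitution is carried out in a measurable version \<open>h\<close> of
      the distance, as the distance itself may fail to be measurable on an arbitrary
      \<open>N\<close>.\<close>
    from strongly_measurable_norm_diff[OF fm this]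
    obtain h where h: "h \<in> borel_measurable N" "AE x in N. norm (f x - s i x) = h x" .
    have "AE x in distr M N T. norm (f x - s i x) = h x" unfolding d by (rule h(2))
    from AE_distrD[OF T this]
    have "(\<integral>\<^sup>+x. norm (f (T x) - s i (T x)) \<partial>M) = (\<integral>\<^sup>+x. h (T x) \<partial>M)"
      by (intro nn_integral_cong_AE) auto
    also have "\<dots> = (\<integral>\<^sup>+x. h x \<partial>distr M N T)"
      using h(1) by (subst nn_integral_distr[OF T]) auto
    also have "\<dots> = (\<integral>\<^sup>+x. norm (f x - s i x) \<partial>N)"
      unfolding d using h(2) by (intro nn_integral_cong_AE) auto
    finally show ?thesis .
  qed
  then show ?thesis
    unfolding has_strong_bochner_integral_def
    using strongly_measurable_comp[OF T d fm] simple_bochner_integral_comp[OF T d s] s0 sI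
    by (intro conjI exI[of _ "\<lambda>i x. s i (T x)"]) auto
qed

section \<open>Translations of the line and measurability of the convolution integrand\<close>

lemma lebesgue_translation:
  fixes c :: real
  shows "(\<lambda>x. c + x) \<in> measurable lebesgue lebesgue" "distr lebesgue lebesgue (\<lambda>x. c + x) = lebesgue"
proof -
  show "(\<lambda>x. c + x) \<in> measurable lebesgue lebesgue"
    using lebesgue_affine_measurable[where c="\<lambda>x::real. 1" and t=c] by simp
  show "distr lebesgue lebesgue (\<lambda>x. c + x) = lebesgue"
    using lebesgue_real_affine[of 1 c] by (simp add: density_1)
qed

lemma nn_integral_translation:
  fixes c :: real
  assumes "g \<in> borel_measurable lebesgue"
  shows "(\<integral>\<^sup>+x. g (c + x) \<partial>lebesgue) = (\<integral>\<^sup>+x. g x \<partial>lebesgue)"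
  using nn_integral_real_affine_lebesgue[OF assms, of 1 c] by simp

lemma AE_lebesgue_neq: "AE s in lebesgue. s \<noteq> (t::real)"
  using AE_lborel_singleton AE_completion by blast

text \<open>\<open>R\<close> is only strongly continuous, so its argument and the vector are both
  replaced by simple functions, which makes the result simple. In the limit,
  \<open>R (r n x) (\<sigma> n x - f x)\<close> is small by the local bound on \<open>R\<close>, and
  \<open>R (r n x) (f x)\<close> converges by strong continuity at the fixed vector
  \<open>f x\<close>.\<close>

lemma strongly_measurable_blinfun_apply:
  fixes R :: "real \<Rightarrow> 'a::real_normed_vector \<Rightarrow>\<^sub>L 'b::real_normed_vector" and f :: "real \<Rightarrow> 'a"
  assumes cont: "\<And>x. continuous_on {0<..} (\<lambda>t. blinfun_apply (R t) x)"
    and bdd: "\<And>a b. 0 < a \<Longrightarrow> \<exists>B. \<forall>t\<in>{a..b}. norm (R t) \<le> B"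
    and f: "strongly_measurable (lebesgue_on {0..t}) f"
  shows "strongly_measurable (lebesgue_on {0..t}) (\<lambda>s. blinfun_apply (R (t - s)) (f s))"
proof -
  let ?M = "lebesgue_on {0..t}"
  obtain \<sigma> where \<sigma>: "\<And>i::nat. simple_function ?M (\<sigma> i)" "AE x in ?M. (\<lambda>i. \<sigma> i x) \<longlonglongrightarrow> f x"
    using f unfolding strongly_measurable_def by blast
  \<comment> \<open>\<open>r n x\<close> approximates \<open>t - x\<close> from above, so it stays away from the singularity of \<open>R\<close> at \<open>0\<close>.\<close>
  define r :: "nat \<Rightarrow> real \<Rightarrow> real" where
    "r n x = (real_of_int \<lfloor>real (Suc n) * (t - x)\<rfloor> + 1) / real (Suc n)" for n x
  have r_ge: "t - x < r n x" and r_le: "r n x \<le> t - x + 1 / real (Suc n)" for n x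
  proof -
    let ?N = "real (Suc n)"
    have "?N * (t - x) < \<lfloor>?N * (t - x)\<rfloor> + 1" "\<lfloor>?N * (t - x)\<rfloor> + 1 \<le> ?N * (t - x) + 1"
      by linarith+
    then have "(?N * (t - x)) / ?N < r n x" "r n x \<le> (?N * (t - x) + 1) / ?N"
      unfolding r_def by (intro divide_strict_right_mono divide_right_mono; simp)+
    then show "t - x < r n x" "r n x \<le> t - x + 1 / real (Suc n)"
      by (simp_all add: add_divide_distrib del: of_nat_Suc)
  qed
  have r_simple: "simple_function ?M (r n)" for n
  proof -
    have "simple_function ?M (\<lambda>x. real_of_int \<lfloor>real (Suc n) * (t - x)\<rfloor>)"
    proof (rule simple_function_borel_measurable)
      show "(\<lambda>x. real_of_int \<lfloor>real (Suc n) * (t - x)\<rfloor>) \<in> borel_measurable ?M"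
        by (intro measurable_restrict_space1 measurable_completion) measurable
      have "(\<lambda>x. real_of_int \<lfloor>real (Suc n) * (t - x)\<rfloor>) ` {0..t}
          \<subseteq> real_of_int ` {0..\<lfloor>real (Suc n) * t\<rfloor>}"
      proof safe
        fix x assume "x \<in> {0..t}"
        then have "\<lfloor>real (Suc n) * (t - x)\<rfloor> \<in> {0..\<lfloor>real (Suc n) * t\<rfloor>}"
          by (auto intro!: floor_mono mult_left_mono mult_nonneg_nonneg simp del: of_nat_Suc)
        then show "real_of_int \<lfloor>real (Suc n) * (t - x)\<rfloor> \<in> real_of_int ` {0..\<lfloor>real (Suc n) * t\<rfloor>}"
          by (rule imageI)
      qed
      then show "finite ((\<lambda>x. real_of_int \<lfloor>real (Suc n) * (t - x)\<rfloor>) ` space ?M)"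
        using finite_subset[OF _ finite_imageI[OF finite_atLeastAtMost_int]] by (simp del: of_nat_Suc)
    qed
    from simple_function_compose1[OF this, of "\<lambda>y. (y + 1) / real (Suc n)"]
    show ?thesis by (simp add: r_def[abs_def])
  qed
  show ?thesis
    unfolding strongly_measurable_def
  proof (intro exI[of _ "\<lambda>n x. blinfun_apply (R (r n x)) (\<sigma> n x)"] conjI allI)
    show "simple_function ?M (\<lambda>x. blinfun_apply (R (r n x)) (\<sigma> n x))" for n
      by (rule simple_function_compose2[OF r_simple \<sigma>(1)])
    \<comment> \<open>At \<open>x = t\<close> the argument of \<open>R\<close> would be 0, where
      nothing is known.\<close>
    have "AE x in ?M. x \<noteq> t"
      using AE_lebesgue_neq[of t] by (auto simp: AE_restrict_space_iff elim: eventually_mono)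
    then show "AE x in ?M. (\<lambda>n. blinfun_apply (R (r n x)) (\<sigma> n x)) \<longlonglongrightarrow> blinfun_apply (R (t - x)) (f x)"
      using \<sigma>(2) AE_space
    proof eventually_elim
      case (elim x)
      then have x: "0 < t - x" by auto
      have r_lim: "(\<lambda>n. r n x) \<longlonglongrightarrow> t - x"
      proof (rule tendsto_sandwich[of "\<lambda>_. t - x" _ _ "\<lambda>n. t - x + 1 / real (Suc n)"])
        show "(\<lambda>n. t - x + 1 / real (Suc n)) \<longlonglongrightarrow> t - x"
          using tendsto_add[OF tendsto_const LIMSEQ_inverse_real_of_nat] by (simp add: inverse_eq_divide)
      qed (use r_ge r_le in \<open>auto intro: less_imp_le always_eventually\<close>)
      obtain B where B: "\<And>u. u \<in> {t - x..t - x + 1} \<Longrightarrow> norm (R u) \<le> B"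
        using bdd[OF x] by blast
      have rx: "r n x \<in> {t - x..t - x + 1}" for n
      proof -
        have "1 / real (Suc n) \<le> 1" by simp
        then show ?thesis
          using r_ge[of x n] r_le[of n x] unfolding atLeastAtMost_iff by linarith
      qed
      have "(\<lambda>n. blinfun_apply (R (r n x)) (\<sigma> n x - f x)) \<longlonglongrightarrow> 0"
      proof (rule Lim_null_comparison)
        show "\<forall>\<^sub>F n in sequentially. norm (blinfun_apply (R (r n x)) (\<sigma> n x - f x)) \<le> B * norm (\<sigma> n x - f x)"
          by (intro always_eventually allI order_trans[OF norm_blinfun] mult_right_mono B rx) simp
        have "(\<lambda>n. B * norm (\<sigma> n x - f x)) \<longlonglongrightarrow> B * norm (f x - f x)"
          by (intro tendsto_intros elim)
        then show "(\<lambda>n. B * norm (\<sigma> n x - f x)) \<longlonglongrightarrow> 0" by simp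
      qed
      moreover have "(\<lambda>n. blinfun_apply (R (r n x)) (f x)) \<longlonglongrightarrow> blinfun_apply (R (t - x)) (f x)"
        by (rule continuous_on_tendsto_compose[OF cont r_lim])
          (use x less_trans[OF x r_ge[of x]] in \<open>auto intro!: always_eventually\<close>)
      ultimately have "(\<lambda>n. blinfun_apply (R (r n x)) (\<sigma> n x - f x) + blinfun_apply (R (r n x)) (f x))
          \<longlonglongrightarrow> 0 + blinfun_apply (R (t - x)) (f x)"
        by (rule tendsto_add)
      then show ?case by (simp add: blinfun.diff_right)
    qed
  qed
qed

section \<open>Convolution kernels\<close>

text \<open>Substitute for Hoelder's inequality: either the left side is at most \<open>\<eta> r powr \<theta>\<close>, or
  \<open>r powr \<gamma>\<close> is bounded by a multiple of \<open>x powr (q - 1)\<close>.\<close>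

lemma young_powr:
  fixes q q' \<gamma> :: real
  assumes q: "q \<ge> 1" and q1: "q > 1 \<longrightarrow> 1 / q + 1 / q' = 1 \<and> q' * \<gamma> > -1"
    and q2: "q = 1 \<longrightarrow> \<gamma> = 0"
  obtains \<theta> where "\<theta> > -1"
    "\<And>\<eta>. \<eta> > 0 \<Longrightarrow> \<exists>c\<ge>0. \<forall>r>0. \<forall>x\<ge>0. r powr \<gamma> * x \<le> \<eta> * r powr \<theta> + c * x powr q"
proof (cases "q = 1")
  case True
  show ?thesis
    by (rule that[of 0], simp, rule exI[of _ 1]) (use True q2 in auto)
next
  case False
  then have q: "q > 1" using q by simp
  have q': "q' = q / (q - 1)"
  proof -
    have "q' \<noteq> 0" using q q1 by auto
    then show ?thesis using q q1 by (auto simp: field_simps)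
  qed
  show ?thesis
  \<comment> \<open>As in Young's inequality, \<open>r powr \<theta>\<close> is the power with
    exponent \<open>q'\<close> of \<open>r powr \<gamma>\<close>.\<close>
  proof (rule that[of "q' * \<gamma>"])
    show "q' * \<gamma> > -1" using q q1 by simp
    fix \<eta> :: real assume \<eta>: "\<eta> > 0"
    show "\<exists>c\<ge>0. \<forall>r>0. \<forall>x\<ge>0. r powr \<gamma> * x \<le> \<eta> * r powr (q' * \<gamma>) + c * x powr q"
    proof (intro exI[of _ "\<eta> powr (1 - q)"] conjI allI impI)
      fix r x :: real assume r: "r > 0" and x: "x \<ge> 0"
      show "r powr \<gamma> * x \<le> \<eta> * r powr (q' * \<gamma>) + \<eta> powr (1 - q) * x powr q"
      proof (cases "r powr \<gamma> * x \<le> \<eta> * r powr (q' * \<gamma>)")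
        case True
        moreover have "0 \<le> \<eta> powr (1 - q) * x powr q" by simp
        ultimately show ?thesis by linarith
      next
        case False
        have e: "q' * \<gamma> = \<gamma> + \<gamma> / (q - 1)"
          unfolding q' using q by (simp add: field_simps)
        \<comment> \<open>The negated inequality divided by \<open>r powr \<gamma>\<close>. Raised
          to the power \<open>q - 1\<close> it bounds \<open>r powr \<gamma>\<close> by
          \<open>\<eta> powr (1 - q) * x powr (q - 1)\<close>, whence the constant.\<close>
        have "\<eta> * r powr (\<gamma> / (q - 1)) < x"
        proof -
          have "r powr \<gamma> * (\<eta> * r powr (\<gamma> / (q - 1))) < r powr \<gamma> * x"
            using False unfolding e powr_add by (simp add: mult_ac)
          then show ?thesis using r by simp
        qed
        moreover have "0 < \<eta> * r powr (\<gamma> / (q - 1))" using r \<eta> by simp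
        ultimately have x0: "x > 0"
          and "(\<eta> * r powr (\<gamma> / (q - 1))) powr (q - 1) < x powr (q - 1)"
          using q by (auto intro: powr_less_mono2)
        then have "\<eta> powr (q - 1) * r powr \<gamma> < x powr (q - 1)"
          using r \<eta> q by (simp add: powr_mult powr_powr)
        then have "\<eta> powr (1 - q) * (\<eta> powr (q - 1) * r powr \<gamma>) * x \<le> \<eta> powr (1 - q) * x powr (q - 1) * x"
          using x by (intro mult_right_mono mult_left_mono) auto
        also have "\<eta> powr (1 - q) * (\<eta> powr (q - 1) * r powr \<gamma>) * x = r powr \<gamma> * x"
          using \<eta> by (simp flip: mult.assoc powr_add)
        also have "\<eta> powr (1 - q) * x powr (q - 1) * x = \<eta> powr (1 - q) * x powr q"
          using x0 by (simp add: powr_diff)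
        finally show ?thesis using \<eta> by (simp add: add_increasing)
      qed
    qed simp
  qed
qed

lemma nn_integral_powr_unit:
  fixes \<theta> t :: real
  assumes "\<theta> > -1"
  shows "(\<integral>\<^sup>+s. ennreal ((t - s) powr \<theta>) * indicator {t - 1..t} s \<partial>lebesgue) = ennreal (1 / (\<theta> + 1))"
proof -
  define F :: "real \<Rightarrow> real" where "F r = r powr \<theta>" for r
  have "(F has_integral (1 powr (\<theta> + 1) / (\<theta> + 1))) {0..1}"
    unfolding F_def[abs_def] by (rule has_integral_powr_from_0) (use assms in auto)
  then have i: "(\<integral>\<^sup>+r. indicator {0..1} r * ennreal (F r) \<partial>lebesgue) = ennreal (1 / (\<theta> + 1))"
    using nn_integral_has_integral_lebesgue[of "{0..1}" F "1 / (\<theta> + 1)"]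
    by (simp add: F_def nn_integral_completion ennreal_mult' ennreal_indicator)
  have m: "(\<lambda>r. indicator {0..1} r * ennreal (F r)) \<in> borel_measurable lebesgue"
    unfolding F_def by (intro measurable_completion) measurable
  have "(\<integral>\<^sup>+s. ennreal ((t - s) powr \<theta>) * indicator {t - 1..t} s \<partial>lebesgue)
      = (\<integral>\<^sup>+s. indicator {0..1} (t + (-1) * s) * ennreal (F (t + (-1) * s)) \<partial>lebesgue)"
    by (intro nn_integral_cong) (auto simp: F_def indicator_def)
  also have "\<dots> = (\<integral>\<^sup>+r. indicator {0..1} r * ennreal (F r) \<partial>lebesgue)"
    using nn_integral_real_affine_lebesgue[OF m, of "-1" t] by simp
  finally show ?thesis using i by simp
qed

text \<open>This is \<open>ln y \<le> y\<close> at \<open>y = s * \<epsilon> / a\<close>, multiplied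
  by \<open>a\<close> and exponentiated. It lets an arbitrarily small exponential rate absorb a
  positive power.\<close>

lemma powr_le_exp:
  fixes a \<epsilon> s :: real
  assumes "a > 0" "\<epsilon> > 0" "s > 0"
  shows "s powr a \<le> (a / \<epsilon>) powr a * exp (\<epsilon> * s)"
proof -
  have "ln (s * \<epsilon> / a) \<le> s * \<epsilon> / a - 1"
    by (rule ln_le_minus_one) (use assms in auto)
  then have "ln (s * \<epsilon> / a) \<le> s * \<epsilon> / a" by simp
  then have "a * ln (s * \<epsilon> / a) \<le> \<epsilon> * s"
    using mult_left_mono[of "ln (s * \<epsilon> / a)" "s * \<epsilon> / a" a] assms by (simp add: mult_ac)
  then have "(s * \<epsilon> / a) powr a \<le> exp (\<epsilon> * s)"
    using assms by (simp add: powr_def)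
  then have "(a / \<epsilon>) powr a * (s * \<epsilon> / a) powr a \<le> (a / \<epsilon>) powr a * exp (\<epsilon> * s)"
    by (intro mult_left_mono) auto
  moreover have "(a / \<epsilon>) powr a * (s * \<epsilon> / a) powr a = s powr a"
    using assms by (simp flip: powr_mult)
  ultimately show ?thesis by simp
qed

text \<open>The part \<open>b * exp (\<rho> * j)\<close> of the bound serves the intervals near \<open>0\<close>, where \<open>\<tau>\<close> is not an
  almost period: these have large \<open>j\<close>, so that a small \<open>b\<close> suffices.\<close>

definition stepanov_kernel :: "real \<Rightarrow> real \<Rightarrow> (real \<Rightarrow> real) \<Rightarrow> bool"
  where "stepanov_kernel \<rho> q k \<longleftrightarrow> (\<forall>\<eta>>0. \<exists>c\<ge>0. \<forall>t g \<delta> b.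
    g \<in> borel_measurable lebesgue \<longrightarrow> (\<forall>s. 0 \<le> g s) \<longrightarrow> 0 \<le> \<delta> \<longrightarrow> 0 \<le> b \<longrightarrow>
    (\<forall>j::nat. (\<integral>\<^sup>+s. ennreal (g s powr q) * indicator {t - j - 1..t - j} s \<partial>lebesgue)
        \<le> ennreal (\<delta> + b * exp (\<rho> * j))) \<longrightarrow>
    (\<integral>\<^sup>+s. ennreal (k (t - s) * g s) * indicator {..<t} s \<partial>lebesgue) \<le> ennreal (\<eta> + c * (\<delta> + b)))"

text \<open>Moving the singularity to the right end of each interval makes all intervals alike:
  \<open>nn_integral_powr_unit\<close> yields the same constant for every \<open>j\<close>, and only
  the factor \<open>exp (- \<omega> * j)\<close> tells them apart.\<close>

lemma nn_integral_exp_powr_le: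
  fixes \<omega> \<gamma> \<theta> \<eta> c q t :: real and g :: "real \<Rightarrow> real"
  assumes "\<omega> > 0" "\<gamma> \<le> 0" "\<theta> > -1" "\<eta> \<ge> 0" "c \<ge> 0"
    and young: "\<And>r x. r > 0 \<Longrightarrow> x \<ge> 0 \<Longrightarrow> r powr \<gamma> * x \<le> \<eta> * r powr \<theta> + c * x powr q"
    and g[measurable]: "g \<in> borel_measurable lebesgue" and g0: "\<And>s. g s \<ge> 0"
  shows "(\<integral>\<^sup>+s. ennreal (exp (- \<omega> * (t - s)) * (t - s) powr \<gamma> * g s) * indicator {..<t} s \<partial>lebesgue)
    \<le> (\<Sum>j. ennreal (exp (- \<omega> * real j)) * (ennreal (\<eta> / (\<theta> + 1))
        + ennreal c * (\<integral>\<^sup>+s. ennreal (g s powr q) * indicator {t - j - 1..t - j} s \<partial>lebesgue)))"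
proof -
  have meas[measurable]: "h \<in> borel_measurable lebesgue" if "h \<in> borel_measurable borel" for h :: "real \<Rightarrow> real"
    by (rule measurable_completion) (use that in simp)
  define u where "u j s = ennreal (exp (- \<omega> * real j))
      * (ennreal \<eta> * (ennreal ((t - real j - s) powr \<theta>) * indicator {t - real j - 1..t - real j} s)
        + ennreal c * (ennreal (g s powr q) * indicator {t - real j - 1..t - real j} s))" for j s
  have [measurable]: "(\<lambda>s. (t - real j - s) powr \<theta>) \<in> borel_measurable lebesgue" for j
    by (rule meas) measurable
  have m1[measurable]: "(\<lambda>s. ennreal ((t - real j - s) powr \<theta>) * indicator {t - real j - 1..t - real j} s)
      \<in> borel_measurable lebesgue" for j
    by measurable
  have m2[measurable]: "(\<lambda>s. ennreal (g s powr q) * indicator {t - real j - 1..t - real j} s)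
      \<in> borel_measurable lebesgue" for j
    by measurable
  have [measurable]: "u j \<in> borel_measurable lebesgue" for j
    unfolding u_def by measurable
  have int_u: "(\<integral>\<^sup>+s. u j s \<partial>lebesgue) = ennreal (exp (- \<omega> * real j)) * (ennreal (\<eta> / (\<theta> + 1))
        + ennreal c * (\<integral>\<^sup>+s. ennreal (g s powr q) * indicator {t - j - 1..t - j} s \<partial>lebesgue))" for j
  proof -
    have "ennreal \<eta> * ennreal (1 / (\<theta> + 1)) = ennreal (\<eta> / (\<theta> + 1))"
      using assms(3,4) by (simp flip: ennreal_mult)
    then show ?thesis
      unfolding u_def
      using nn_integral_powr_unit[OF assms(3), of "t - real j"]
      by (simp add: nn_integral_cmult nn_integral_add)
  qed
  have "ennreal (exp (- \<omega> * (t - s)) * (t - s) powr \<gamma> * g s) * indicator {..<t} s \<le> (\<Sum>j. u j s)" for s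
  proof (cases "s < t")
    case True
    \<comment> \<open>The ceiling, not the floor: \<open>t - j - s\<close> stays positive also when
      \<open>t - s\<close> is an integer, where otherwise \<open>0 powr \<gamma> = 0\<close> would
      break the bound.\<close>
    define j where "j = nat (\<lceil>t - s\<rceil> - 1)"
    have j: "real j = of_int \<lceil>t - s\<rceil> - 1"
      using True by (simp add: j_def)
    then have j1: "real j < t - s" and j2: "t - s \<le> real j + 1"
      by linarith+
    have "exp (- \<omega> * (t - s)) * (t - s) powr \<gamma> * g s
        \<le> exp (- \<omega> * real j) * (t - real j - s) powr \<gamma> * g s"
      using assms(1,2) j1 g0 True
      by (intro mult_right_mono mult_mono powr_mono2') auto
    also have "\<dots> = exp (- \<omega> * real j) * ((t - real j - s) powr \<gamma> * g s)"
      by simp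
    also have "\<dots> \<le> exp (- \<omega> * real j) * (\<eta> * (t - real j - s) powr \<theta> + c * g s powr q)"
      using j1 g0 by (intro mult_left_mono young) auto
    finally have "ennreal (exp (- \<omega> * (t - s)) * (t - s) powr \<gamma> * g s)
        \<le> ennreal (exp (- \<omega> * real j) * (\<eta> * (t - real j - s) powr \<theta> + c * g s powr q))"
      by (rule ennreal_leI)
    also have "\<dots> = u j s"
      using j1 j2 assms(4,5) by (simp add: u_def ennreal_mult ennreal_plus)
    also have "\<dots> \<le> (\<Sum>j. u j s)"
      using sum_le_suminf[of "\<lambda>j. u j s" "{j}"] by simp
    finally show ?thesis using True by simp
  qed simp
  then have "(\<integral>\<^sup>+s. ennreal (exp (- \<omega> * (t - s)) * (t - s) powr \<gamma> * g s) * indicator {..<t} s \<partial>lebesgue)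
      \<le> (\<integral>\<^sup>+s. (\<Sum>j. u j s) \<partial>lebesgue)"
    by (rule nn_integral_mono)
  also have "\<dots> = (\<Sum>j. \<integral>\<^sup>+s. u j s \<partial>lebesgue)"
    by (rule nn_integral_suminf) measurable
  finally show ?thesis unfolding int_u .
qed

text \<open>Half of the rate pays for the growth \<open>exp (\<omega> / 2 * j)\<close> that the
  local bounds may have; the other half leaves the convergent geometric series
  \<open>S\<close>.\<close>

lemma stepanov_kernel_exp_powr:
  fixes \<omega> \<gamma> q q' :: real
  assumes \<omega>: "\<omega> > 0" and \<gamma>: "\<gamma> \<le> 0" and q: "q \<ge> 1"
    and q1: "q > 1 \<longrightarrow> 1 / q + 1 / q' = 1 \<and> q' * \<gamma> > -1" and q2: "q = 1 \<longrightarrow> \<gamma> = 0"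
  shows "stepanov_kernel (\<omega> / 2) q (\<lambda>s. exp (- \<omega> * s) * s powr \<gamma>)"
proof -
  obtain \<theta> where \<theta>: "\<theta> > -1"
    and young: "\<And>\<eta>. \<eta> > 0 \<Longrightarrow> \<exists>c\<ge>0. \<forall>r>0. \<forall>x\<ge>0. r powr \<gamma> * x \<le> \<eta> * r powr \<theta> + c * x powr q"
    using young_powr[OF q q1 q2] by blast
  define S where "S = (\<Sum>j. exp (- (\<omega> / 2)) ^ j)"
  have ex: "exp (- (\<omega> / 2)) < 1" using \<omega> by simp
  have S: "(\<lambda>j. exp (- (\<omega> / 2)) ^ j) sums S"
    unfolding S_def using ex by (intro summable_sums summable_geometric) simp
  have "0 < S"
    unfolding S_def using ex by (subst suminf_geometric) auto
  show ?thesis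
    unfolding stepanov_kernel_def
  proof (intro allI impI)
    fix \<eta> :: real assume \<eta>: "\<eta> > 0"
    \<comment> \<open>Integration over a unit interval divides by \<open>\<theta> + 1\<close> and
      summation multiplies by \<open>S\<close>; this choice leaves exactly \<eta>.\<close>
    define \<eta>' where "\<eta>' = \<eta> * (\<theta> + 1) / S"
    have \<eta>': "\<eta>' > 0" using \<eta> \<theta> \<open>0 < S\<close> by (simp add: \<eta>'_def)
    obtain c where c: "c \<ge> 0"
      "\<And>r x. r > 0 \<Longrightarrow> x \<ge> 0 \<Longrightarrow> r powr \<gamma> * x \<le> \<eta>' * r powr \<theta> + c * x powr q"
      using young[OF \<eta>'] by auto
    show "\<exists>c\<ge>0. \<forall>t g \<delta> b.
      g \<in> borel_measurable lebesgue \<longrightarrow> (\<forall>s. 0 \<le> g s) \<longrightarrow> 0 \<le> \<delta> \<longrightarrow> 0 \<le> b \<longrightarrow>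
      (\<forall>j::nat. (\<integral>\<^sup>+s. ennreal (g s powr q) * indicator {t - j - 1..t - j} s \<partial>lebesgue)
          \<le> ennreal (\<delta> + b * exp (\<omega> / 2 * j))) \<longrightarrow>
      (\<integral>\<^sup>+s. ennreal (exp (- \<omega> * (t - s)) * (t - s) powr \<gamma> * g s) * indicator {..<t} s \<partial>lebesgue)
        \<le> ennreal (\<eta> + c * (\<delta> + b))"
    proof (intro exI[of _ "S * c"] conjI allI impI)
      fix t \<delta> b :: real and g :: "real \<Rightarrow> real"
      assume g: "g \<in> borel_measurable lebesgue" "\<forall>s. 0 \<le> g s" and \<delta>: "0 \<le> \<delta>" and b: "0 \<le> b"
        and E: "\<forall>j::nat. (\<integral>\<^sup>+s. ennreal (g s powr q) * indicator {t - j - 1..t - j} s \<partial>lebesgue)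
          \<le> ennreal (\<delta> + b * exp (\<omega> / 2 * j))"
      define K where "K = \<eta>' / (\<theta> + 1) + c * (\<delta> + b)"
      have K: "K \<ge> 0" using \<eta>' \<theta> c \<delta> b by (simp add: K_def)
      have summand: "ennreal (exp (- \<omega> * real j)) * (ennreal (\<eta>' / (\<theta> + 1))
        + ennreal c * (\<integral>\<^sup>+s. ennreal (g s powr q) * indicator {t - j - 1..t - j} s \<partial>lebesgue))
          \<le> ennreal (exp (- (\<omega> / 2)) ^ j * K)" (is "?L \<le> _") for j :: nat
      proof -
        have "?L \<le> ennreal (exp (- \<omega> * real j)) * (ennreal (\<eta>' / (\<theta> + 1))
            + ennreal c * ennreal (\<delta> + b * exp (\<omega> / 2 * j)))"
          by (intro mult_left_mono add_left_mono E[rule_format]) auto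
        also have "\<dots> = ennreal (exp (- \<omega> * real j) * (\<eta>' / (\<theta> + 1) + c * (\<delta> + b * exp (\<omega> / 2 * j))))"
          using \<eta>' \<theta> c \<delta> b by (simp add: ennreal_mult ennreal_plus)
        also have "\<dots> \<le> ennreal (exp (- (\<omega> / 2)) ^ j * K)"
        proof (rule ennreal_leI)
          \<comment> \<open>The terms without growth are given the factor
            \<open>exp (\<omega> / 2 * j)\<close> too, so that every summand is \<open>K\<close>
            times a term of the geometric series.\<close>
          have e1: "1 \<le> exp (\<omega> / 2 * j)" using \<omega> by simp
          have "\<delta> \<le> \<delta> * exp (\<omega> / 2 * j)" "\<eta>' / (\<theta> + 1) \<le> \<eta>' / (\<theta> + 1) * exp (\<omega> / 2 * j)"
            using mult_left_mono[OF e1, of \<delta>] mult_left_mono[OF e1, of "\<eta>' / (\<theta> + 1)"] \<delta> \<eta>' \<theta> by auto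
          then have "\<eta>' / (\<theta> + 1) + c * (\<delta> + b * exp (\<omega> / 2 * j))
              \<le> \<eta>' / (\<theta> + 1) * exp (\<omega> / 2 * j) + c * (\<delta> * exp (\<omega> / 2 * j) + b * exp (\<omega> / 2 * j))"
            using c(1) b by (intro add_mono mult_left_mono) auto
          also have "\<dots> = K * exp (\<omega> / 2 * j)"
            by (simp add: K_def algebra_simps)
          finally have "exp (- \<omega> * real j) * (\<eta>' / (\<theta> + 1) + c * (\<delta> + b * exp (\<omega> / 2 * j)))
              \<le> exp (- \<omega> * real j) * (K * exp (\<omega> / 2 * j))"
            by (intro mult_left_mono) auto
          also have "\<dots> = exp (- (\<omega> / 2)) ^ j * K"
            by (simp flip: exp_of_nat_mult exp_add)
          finally show "exp (- \<omega> * real j) * (\<eta>' / (\<theta> + 1) + c * (\<delta> + b * exp (\<omega> / 2 * j)))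
              \<le> exp (- (\<omega> / 2)) ^ j * K" .
        qed
        finally show ?thesis .
      qed
      have "(\<integral>\<^sup>+s. ennreal (exp (- \<omega> * (t - s)) * (t - s) powr \<gamma> * g s) * indicator {..<t} s \<partial>lebesgue)
          \<le> (\<Sum>j. ennreal (exp (- \<omega> * real j)) * (ennreal (\<eta>' / (\<theta> + 1))
        + ennreal c * (\<integral>\<^sup>+s. ennreal (g s powr q) * indicator {t - j - 1..t - j} s \<partial>lebesgue)))"
        by (rule nn_integral_exp_powr_le) (use \<omega> \<gamma> \<theta> \<eta>' c g in auto)
      also have "\<dots> \<le> (\<Sum>j. ennreal (exp (- (\<omega> / 2)) ^ j * K))"
        by (intro suminf_le summand) auto
      also have "\<dots> = ennreal (S * K)"
        using K \<open>0 < S\<close> by (intro sums_unique[symmetric] sums_ennreal[THEN iffD2] sums_mult2 S) auto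
      also have "S * K = \<eta> + S * c * (\<delta> + b)"
              proof -
        have "\<eta>' / (\<theta> + 1) = \<eta> / S" using \<theta> by (simp add: \<eta>'_def)
        then show ?thesis using \<open>0 < S\<close> by (simp add: K_def distrib_left)
      qed
      finally show "(\<integral>\<^sup>+s. ennreal (exp (- \<omega> * (t - s)) * (t - s) powr \<gamma> * g s) * indicator {..<t} s \<partial>lebesgue)
        \<le> ennreal (\<eta> + S * c * (\<delta> + b))" .
    qed (use \<open>0 < S\<close> c in auto)
  qed
qed

text \<open>The factor \<open>D\<close> is moved from the kernel into \<open>g\<close>. Thus \<eta>
  is unaffected, and the local integrals gain \<open>D powr q\<close>, which enters the new
  constant.\<close>

lemma stepanov_kernel_dominated:
  assumes k: "stepanov_kernel \<rho> q k" and D: "D \<ge> 0" and le: "\<And>s. s > 0 \<Longrightarrow> k' s \<le> D * k s"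
  shows "stepanov_kernel \<rho> q k'"
  unfolding stepanov_kernel_def
proof (intro allI impI)
  fix \<eta> :: real assume \<eta>: "\<eta> > 0"
  obtain c where c: "c \<ge> 0" "\<And>t g \<delta> b.
    g \<in> borel_measurable lebesgue \<Longrightarrow> (\<forall>s. 0 \<le> g s) \<Longrightarrow> 0 \<le> \<delta> \<Longrightarrow> 0 \<le> b \<Longrightarrow>
    (\<forall>j::nat. (\<integral>\<^sup>+s. ennreal (g s powr q) * indicator {t - j - 1..t - j} s \<partial>lebesgue)
        \<le> ennreal (\<delta> + b * exp (\<rho> * j))) \<Longrightarrow>
    (\<integral>\<^sup>+s. ennreal (k (t - s) * g s) * indicator {..<t} s \<partial>lebesgue) \<le> ennreal (\<eta> + c * (\<delta> + b))"
    using k[unfolded stepanov_kernel_def, rule_format, of "\<eta>"] \<eta> by auto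
  show "\<exists>c\<ge>0. \<forall>t g \<delta> b.
      g \<in> borel_measurable lebesgue \<longrightarrow> (\<forall>s. 0 \<le> g s) \<longrightarrow> 0 \<le> \<delta> \<longrightarrow> 0 \<le> b \<longrightarrow>
      (\<forall>j::nat. (\<integral>\<^sup>+s. ennreal (g s powr q) * indicator {t - j - 1..t - j} s \<partial>lebesgue)
          \<le> ennreal (\<delta> + b * exp (\<rho> * j))) \<longrightarrow>
      (\<integral>\<^sup>+s. ennreal (k' (t - s) * g s) * indicator {..<t} s \<partial>lebesgue) \<le> ennreal (\<eta> + c * (\<delta> + b))"
  proof (intro exI[of _ "c * D powr q"] conjI allI impI)
    fix t \<delta> b :: real and g :: "real \<Rightarrow> real"
    assume g[measurable]: "g \<in> borel_measurable lebesgue" and g0: "\<forall>s. 0 \<le> g s" and \<delta>: "0 \<le> \<delta>" and b: "0 \<le> b"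
      and E: "\<forall>j::nat. (\<integral>\<^sup>+s. ennreal (g s powr q) * indicator {t - j - 1..t - j} s \<partial>lebesgue)
        \<le> ennreal (\<delta> + b * exp (\<rho> * j))"
    have m: "(\<lambda>s. D * g s) \<in> borel_measurable lebesgue" by measurable
    have E': "\<forall>j::nat. (\<integral>\<^sup>+s. ennreal ((D * g s) powr q) * indicator {t - j - 1..t - j} s \<partial>lebesgue)
        \<le> ennreal (D powr q * \<delta> + D powr q * b * exp (\<rho> * j))"
    proof
      fix j :: nat
      have [measurable]: "(\<lambda>s. ennreal (g s powr q) * indicator {t - j - 1..t - j} s) \<in> borel_measurable lebesgue"
        by (intro borel_measurable_times_ennreal borel_measurable_indicator) (measurable, simp)
      have "(\<integral>\<^sup>+s. ennreal ((D * g s) powr q) * indicator {t - j - 1..t - j} s \<partial>lebesgue)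
          = (\<integral>\<^sup>+s. ennreal (D powr q) * (ennreal (g s powr q) * indicator {t - j - 1..t - j} s) \<partial>lebesgue)"
        using D g0 by (intro nn_integral_cong) (simp add: powr_mult ennreal_mult mult.assoc)
      also have "\<dots> = ennreal (D powr q) * (\<integral>\<^sup>+s. ennreal (g s powr q) * indicator {t - j - 1..t - j} s \<partial>lebesgue)"
        by (rule nn_integral_cmult) measurable
      also have "\<dots> \<le> ennreal (D powr q) * ennreal (\<delta> + b * exp (\<rho> * j))"
        by (intro mult_left_mono E[rule_format]) auto
      also have "\<dots> = ennreal (D powr q * \<delta> + D powr q * b * exp (\<rho> * j))"
        using \<delta> b by (simp add: ennreal_mult[symmetric] algebra_simps)
      finally show "(\<integral>\<^sup>+s. ennreal ((D * g s) powr q) * indicator {t - j - 1..t - j} s \<partial>lebesgue)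
        \<le> ennreal (D powr q * \<delta> + D powr q * b * exp (\<rho> * j))" .
    qed
    have "(\<integral>\<^sup>+s. ennreal (k' (t - s) * g s) * indicator {..<t} s \<partial>lebesgue)
        \<le> (\<integral>\<^sup>+s. ennreal (k (t - s) * (D * g s)) * indicator {..<t} s \<partial>lebesgue)"
    proof (intro nn_integral_mono)
      fix s
      show "ennreal (k' (t - s) * g s) * indicator {..<t} s \<le> ennreal (k (t - s) * (D * g s)) * indicator {..<t} s"
        using mult_right_mono[OF le[of "t - s"], of "g s"] g0
        by (auto simp: indicator_def mult_ac intro!: ennreal_leI)
    qed
    also have "\<dots> \<le> ennreal (\<eta> + c * (D powr q * \<delta> + D powr q * b))"
      using c(2)[OF m _ _ _ E'] D g0 \<delta> b by simp
    finally show "(\<integral>\<^sup>+s. ennreal (k' (t - s) * g s) * indicator {..<t} s \<partial>lebesgue)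
        \<le> ennreal (\<eta> + c * D powr q * (\<delta> + b))"
      by (simp add: algebra_simps)
  qed (use c in auto)
qed

section \<open>Local norms of translation differences\<close>

definition half_line :: "(real \<Rightarrow> 'a::real_normed_vector) \<Rightarrow> real \<Rightarrow> 'a"
  where "half_line f s = indicator {0..} s *\<^sub>R f s"

text \<open>The local norm is kept as a \<open>q\<close>-th power and as a nonnegative integral over
  the whole line: it can be split, dominated and translated before finiteness is known, and it makes
  sense for negative \<open>a\<close>, which occur as \<open>t - j - 1\<close>.\<close>

definition stepanov_diff :: "real \<Rightarrow> (real \<Rightarrow> 'a::real_normed_vector) \<Rightarrow> real \<Rightarrow> real \<Rightarrow> ennreal"
  where "stepanov_diff q f \<tau> a =
    (\<integral>\<^sup>+s. ennreal (norm (half_line f (\<tau> + s) - half_line f s) powr q) * indicator {a..a + 1} s \<partial>lebesgue)"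

section \<open>Measurability of the extension by zero\<close>

lemma strongly_measurable_Lq_loc:
  assumes "f \<in> Lq_loc q"
  shows "strongly_measurable lebesgue (\<lambda>s. indicator {0..real n} s *\<^sub>R f s)"
  by (rule strongly_measurable_restrict_space)
    (use assms in \<open>auto simp: Lq_loc_def Lq_def\<close>)

text \<open>\<open>Lq_loc\<close> speaks of bounded intervals only. The truncations to these are
  eventually constant at each point, so measurability of the norms passes to
  \<open>half_line f\<close>.\<close>

lemma eventually_half_line:
  "\<forall>\<^sub>F n in sequentially. indicator {0..real n} s *\<^sub>R f s = half_line f s"
proof -
  obtain N :: nat where "s \<le> real N" using real_arch_simple by blast
  then show ?thesis
    by (intro eventually_sequentiallyI[of N]) (auto simp: half_line_def indicator_def)
qed

lemma measurable_norm_half_line: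
  assumes "f \<in> Lq_loc q"
  shows "(\<lambda>s. norm (half_line f s)) \<in> borel_measurable lebesgue"
proof (rule borel_measurable_LIMSEQ_real)
  show "(\<lambda>s. norm (indicator {0..real n} s *\<^sub>R f s)) \<in> borel_measurable lebesgue" for n
    by (rule completion.borel_measurable_norm_strongly[OF strongly_measurable_Lq_loc[OF assms]])
  show "(\<lambda>n. norm (indicator {0..real n} s *\<^sub>R f s)) \<longlonglongrightarrow> norm (half_line f s)" for s
    by (intro tendsto_norm tendsto_eventually eventually_half_line)
qed

lemma measurable_norm_half_line_diff:
  assumes "f \<in> Lq_loc q"
  shows "(\<lambda>s. norm (half_line f (\<tau> + s) - half_line f s)) \<in> borel_measurable lebesgue"
proof (rule borel_measurable_LIMSEQ_real)
  let ?f = "\<lambda>n s. indicator {0..real n} s *\<^sub>R f s"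
  show "(\<lambda>s. norm (?f n (\<tau> + s) - ?f n s)) \<in> borel_measurable lebesgue" for n
    by (intro completion.borel_measurable_norm_strongly strongly_measurable_diff
        strongly_measurable_Lq_loc[OF assms]
        strongly_measurable_comp[OF lebesgue_translation strongly_measurable_Lq_loc[OF assms]])
  show "(\<lambda>n. norm (?f n (\<tau> + s) - ?f n s)) \<longlonglongrightarrow> norm (half_line f (\<tau> + s) - half_line f s)" for s
    by (intro tendsto_norm tendsto_diff tendsto_eventually eventually_half_line)
qed

lemma measurable_times_indicator:
  assumes "h \<in> borel_measurable lebesgue"
  shows "(\<lambda>s. ennreal (h s powr q) * indicator {a..b::real} s) \<in> borel_measurable lebesgue"
proof (intro borel_measurable_times_ennreal borel_measurable_indicator)
  show "(\<lambda>s. ennreal (h s powr q)) \<in> borel_measurable lebesgue"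
    using assms by measurable
qed simp

section \<open>Uniform bounds on the local norms\<close>

lemma nn_integral_lebesgue_on:
  fixes h :: "real \<Rightarrow> real"
  assumes "A \<in> sets lebesgue" "integrable (lebesgue_on A) h" "\<And>x. h x \<ge> 0"
  shows "(\<integral>\<^sup>+s. ennreal (h s) * indicator A s \<partial>lebesgue) = ennreal (\<integral>s. h s \<partial>lebesgue_on A)"
  using assms nn_integral_restrict_space[of A lebesgue "\<lambda>s. ennreal (h s)"]
  by (simp add: nn_integral_eq_integral)

lemma integrable_lebesgue_onI:
  fixes h :: "real \<Rightarrow> real"
  assumes A: "A \<in> sets lebesgue" and h: "h \<in> borel_measurable lebesgue" "\<And>x. h x \<ge> 0"
    and fin: "(\<integral>\<^sup>+s. ennreal (h s) * indicator A s \<partial>lebesgue) < \<infinity>"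
  shows "integrable (lebesgue_on A) h"
proof (rule integrableI_bounded)
  show "h \<in> borel_measurable (lebesgue_on A)" using h(1) by (rule measurable_restrict_space1)
  show "(\<integral>\<^sup>+x. ennreal (norm (h x)) \<partial>lebesgue_on A) < \<infinity>"
    using fin A h(2) by (simp add: nn_integral_restrict_space)
qed

lemma stepanov_bound:
  assumes f: "f \<in> AAPS q" and q: "q \<ge> 1"
  obtains B where "B \<ge> 0"
    "\<And>a. (\<integral>\<^sup>+s. ennreal (norm (half_line f s) powr q) * indicator {a..a + 1} s \<partial>lebesgue) \<le> ennreal B"
proof -
  have loc: "f \<in> Lq_loc q" using f by (simp add: AAPS_def)
  obtain B where B: "\<And>t. t \<ge> 0 \<Longrightarrow> (\<integral>s. norm (f s) powr q \<partial>lebesgue_on {t..t + 1}) powr (1 / q) \<le> B"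
    using f by (auto simp: AAPS_def bdd_above_def)
  have nonneg: "(\<integral>\<^sup>+s. ennreal (norm (half_line f s) powr q) * indicator {a..a + 1} s \<partial>lebesgue)
      \<le> ennreal (B powr q)" if a: "a \<ge> 0" for a
  proof -
    have "integrable (lebesgue_on {0..a + 1}) (\<lambda>s. norm (f s) powr q)"
      using loc a by (simp add: Lq_loc_def Lq_def)
    then have "set_integrable lebesgue {0..a + 1} (\<lambda>s. norm (f s) powr q)"
      by (simp add: set_integrable_def integrable_restrict_space)
    then have "set_integrable lebesgue {a..a + 1} (\<lambda>s. norm (f s) powr q)"
      by (rule set_integrable_subset) (use a in auto)
    then have i: "integrable (lebesgue_on {a..a + 1}) (\<lambda>s. norm (f s) powr q)"
      by (simp add: set_integrable_def integrable_restrict_space)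
    let ?I = "\<integral>s. norm (f s) powr q \<partial>lebesgue_on {a..a + 1}"
    have "(\<integral>\<^sup>+s. ennreal (norm (half_line f s) powr q) * indicator {a..a + 1} s \<partial>lebesgue)
        = (\<integral>\<^sup>+s. ennreal (norm (f s) powr q) * indicator {a..a + 1} s \<partial>lebesgue)"
      using a by (intro nn_integral_cong) (auto simp: half_line_def indicator_def)
    also have "\<dots> = ennreal ?I"
      by (rule nn_integral_lebesgue_on[OF _ i]) auto
    also have "?I \<ge> 0" by (rule integral_nonneg_AE) auto
    then have "?I = (?I powr (1 / q)) powr q" using q by (simp add: powr_powr)
    also have "\<dots> \<le> B powr q"
      using q by (intro powr_mono2 B a) auto
    finally show ?thesis by (simp add: ennreal_leI)
  qed
  show ?thesis
  proof (rule that[of "B powr q"])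
    fix a
    show "(\<integral>\<^sup>+s. ennreal (norm (half_line f s) powr q) * indicator {a..a + 1} s \<partial>lebesgue) \<le> ennreal (B powr q)"
    proof (cases "a \<ge> 0")
      case False
      \<comment> \<open>For negative \<open>a\<close> the interval meets the half-line inside
        \<open>{0..1}\<close>.\<close>
      have "(\<integral>\<^sup>+s. ennreal (norm (half_line f s) powr q) * indicator {a..a + 1} s \<partial>lebesgue)
          \<le> (\<integral>\<^sup>+s. ennreal (norm (half_line f s) powr q) * indicator {0..0 + 1} s \<partial>lebesgue)"
        using False by (intro nn_integral_mono) (auto simp: half_line_def indicator_def)
      then show ?thesis using nonneg[of 0] by simp
    qed (rule nonneg)
  qed simp
qed

text \<open>A sum of two norms is at most twice their maximum, and the \<open>q\<close>-th power of
  a maximum is at most the sum of the powers.\<close>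

lemma norm_diff_powr_le:
  fixes u v :: "'a::real_normed_vector"
  assumes "q \<ge> 1"
  shows "norm (u - v) powr q \<le> 2 powr q * (norm u powr q + norm v powr q)"
proof -
  have "norm (u - v) \<le> 2 * max (norm u) (norm v)"
    using norm_triangle_ineq4[of u v] by linarith
  then have "norm (u - v) powr q \<le> (2 * max (norm u) (norm v)) powr q"
    using assms by (intro powr_mono2) auto
  also have "\<dots> = 2 powr q * max (norm u) (norm v) powr q"
    by (simp add: powr_mult)
  also have "\<dots> \<le> 2 powr q * (norm u powr q + norm v powr q)"
    by (intro mult_left_mono) (auto simp: max_def)
  finally show ?thesis .
qed

lemma stepanov_diff_bound:
  assumes f: "f \<in> AAPS q" and q: "q \<ge> 1"
  obtains B where "B > 0" "\<And>\<tau> a. stepanov_diff q f \<tau> a \<le> ennreal B"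
proof -
  have loc: "f \<in> Lq_loc q" using f by (simp add: AAPS_def)
  let ?\<phi> = "\<lambda>a s. ennreal (norm (half_line f s) powr q) * indicator {a..a + 1} s"
  obtain B where B: "B \<ge> 0" "\<And>a. (\<integral>\<^sup>+s. ?\<phi> a s \<partial>lebesgue) \<le> ennreal B"
    using stepanov_bound[OF f q] by blast
  have m: "?\<phi> a \<in> borel_measurable lebesgue" for a
    by (rule measurable_times_indicator[OF measurable_norm_half_line[OF loc]])
  have m': "(\<lambda>s. ?\<phi> a (\<tau> + s)) \<in> borel_measurable lebesgue" for a \<tau>
    by (rule measurable_compose[OF lebesgue_translation(1) m])
  show ?thesis
  proof (rule that[of "2 powr q * (B + B) + 1"])
    show "0 < 2 powr q * (B + B) + 1" using B(1) by (simp add: add_nonneg_pos)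
    fix \<tau> a
    have "stepanov_diff q f \<tau> a \<le> (\<integral>\<^sup>+s. ennreal (2 powr q) * (?\<phi> (\<tau> + a) (\<tau> + s) + ?\<phi> a s) \<partial>lebesgue)"
      unfolding stepanov_diff_def
    proof (rule nn_integral_mono)
      fix s
      show "ennreal (norm (half_line f (\<tau> + s) - half_line f s) powr q) * indicator {a..a + 1} s
          \<le> ennreal (2 powr q) * (?\<phi> (\<tau> + a) (\<tau> + s) + ?\<phi> a s)"
        using ennreal_leI[OF norm_diff_powr_le[OF q, of "half_line f (\<tau> + s)" "half_line f s"]]
        by (auto simp: indicator_def ennreal_mult ennreal_plus)
    qed
    also have "\<dots> = ennreal (2 powr q) * ((\<integral>\<^sup>+s. ?\<phi> (\<tau> + a) (\<tau> + s) \<partial>lebesgue) + (\<integral>\<^sup>+s. ?\<phi> a s \<partial>lebesgue))"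
      using m m' by (simp add: nn_integral_cmult nn_integral_add)
    also have "(\<integral>\<^sup>+s. ?\<phi> (\<tau> + a) (\<tau> + s) \<partial>lebesgue) = (\<integral>\<^sup>+s. ?\<phi> (\<tau> + a) s \<partial>lebesgue)"
      by (rule nn_integral_translation[OF m])
    also have "ennreal (2 powr q) * ((\<integral>\<^sup>+s. ?\<phi> (\<tau> + a) s \<partial>lebesgue) + (\<integral>\<^sup>+s. ?\<phi> a s \<partial>lebesgue))
        \<le> ennreal (2 powr q) * (ennreal B + ennreal B)"
      by (intro mult_left_mono add_mono B) auto
    also have "\<dots> = ennreal (2 powr q * (B + B))"
      unfolding ennreal_plus[OF B(1) B(1), symmetric] using B(1) by (intro ennreal_mult[symmetric]) auto
    also have "\<dots> \<le> ennreal (2 powr q * (B + B) + 1)"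
      by (rule ennreal_leI) simp
    finally show "stepanov_diff q f \<tau> a \<le> ennreal (2 powr q * (B + B) + 1)" .
  qed
qed

text \<open>The bridge to the norm in which almost periodicity of \<open>f\<close> is expressed. For
  nonnegative \<open>a\<close> and \<tau> the extension by zero is not felt.\<close>

lemma stepanov_diff_eq_Lq_norm:
  assumes f: "f \<in> AAPS q" and q: "q \<ge> 1" and \<tau>: "\<tau> \<ge> 0" and a: "a \<ge> 0"
  shows "stepanov_diff q f \<tau> a
    = ennreal (Lq_norm q (lebesgue_on {0..1}) ((\<lambda>x. f (a + \<tau> + x)) - (\<lambda>x. f (a + x))) powr q)"
proof -
  have loc: "f \<in> Lq_loc q" using f by (simp add: AAPS_def)
  let ?g = "\<lambda>s. norm (half_line f (\<tau> + s) - half_line f s)"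
  let ?h = "\<lambda>x. ?g (a + x) powr q"
  have g: "?g \<in> borel_measurable lebesgue"
    by (rule measurable_norm_half_line_diff[OF loc])
  have ga: "(\<lambda>x. ?g (a + x)) \<in> borel_measurable lebesgue"
    by (rule measurable_compose[OF lebesgue_translation(1) g])
  obtain B where B: "stepanov_diff q f \<tau> a \<le> ennreal B"
    using stepanov_diff_bound[OF f q] by blast
  have "stepanov_diff q f \<tau> a = (\<integral>\<^sup>+x. ennreal (?h x) * indicator {a..a + 1} (a + x) \<partial>lebesgue)"
    unfolding stepanov_diff_def
    by (rule nn_integral_translation[symmetric, OF measurable_times_indicator[OF g]])
  also have "\<dots> = (\<integral>\<^sup>+x. ennreal (?h x) * indicator {0..1} x \<partial>lebesgue)"
    by (intro nn_integral_cong) (auto simp: indicator_def)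
  finally have eq: "stepanov_diff q f \<tau> a = (\<integral>\<^sup>+x. ennreal (?h x) * indicator {0..1} x \<partial>lebesgue)" .
  \<comment> \<open>Integrability must be established first: otherwise the integral inside
    \<open>Lq_norm\<close> would be the default value 0.\<close>
  have "(\<integral>\<^sup>+x. ennreal (?h x) * indicator {0..1} x \<partial>lebesgue) < \<infinity>"
    using B unfolding eq by (simp add: order_le_less_trans)
  then have "integrable (lebesgue_on {0..1}) ?h"
    using ga by (intro integrable_lebesgue_onI) auto
  then have "stepanov_diff q f \<tau> a = ennreal (\<integral>x. ?h x \<partial>lebesgue_on {0..1})"
    unfolding eq by (intro nn_integral_lebesgue_on) auto
  also have "(\<integral>x. ?h x \<partial>lebesgue_on {0..1}) = (\<integral>x. norm (f (a + \<tau> + x) - f (a + x)) powr q \<partial>lebesgue_on {0..1})"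
    using \<tau> a by (intro Bochner_Integration.integral_cong) (auto simp: half_line_def add_ac)
  also have "\<dots> = Lq_norm q (lebesgue_on {0..1}) ((\<lambda>x. f (a + \<tau> + x)) - (\<lambda>x. f (a + x))) powr q"
  proof -
    have "(\<integral>x. norm (f (a + \<tau> + x) - f (a + x)) powr q \<partial>lebesgue_on {0..1}) \<ge> 0"
      by (rule integral_nonneg_AE) auto
    then show ?thesis
      using q by (simp add: Lq_norm_def powr_powr)
  qed
  finally show ?thesis .
qed

text \<open>Almost periods of the translates of \<open>f\<close>, taken at level
  \<open>\<delta> powr (1 / q)\<close> because \<open>stepanov_diff\<close> is a \<open>q\<close>-th
  power.\<close>

lemma stepanov_diff_almost_period:
  assumes f: "f \<in> AAPS q" and q: "q \<ge> 1" and \<delta>: "\<delta> > 0"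
  shows "\<exists>l>0. \<exists>M>0. \<forall>a\<ge>0. \<exists>\<tau>\<in>{a..a + l}. \<forall>b\<ge>M. stepanov_diff q f \<tau> b \<le> ennreal \<delta>"
proof -
  let ?N = "Lq_norm q (lebesgue_on {0..1})"
  have "(\<lambda>t x. f (t + x)) \<in> AAP_in (Lq q (lebesgue_on {0..1})) ?N"
    using f by (simp add: AAPS_def)
  then have "\<forall>\<epsilon>>0. \<exists>l>0. \<exists>M>0. \<forall>a\<ge>0. \<exists>\<tau>\<in>{a..a + l}. \<forall>t\<ge>M.
      ?N ((\<lambda>x. f (t + \<tau> + x)) - (\<lambda>x. f (t + x))) \<le> \<epsilon>"
    unfolding AAP_in_def mem_Collect_eq by (elim conjE)
  moreover have "\<delta> powr (1 / q) > 0" using \<delta> by simp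
  ultimately have "\<exists>l>0. \<exists>M>0. \<forall>a\<ge>0. \<exists>\<tau>\<in>{a..a + l}. \<forall>t\<ge>M.
      ?N ((\<lambda>x. f (t + \<tau> + x)) - (\<lambda>x. f (t + x))) \<le> \<delta> powr (1 / q)"
    by (elim allE[of _ "\<delta> powr (1 / q)"]) (erule mp)
  then obtain l M where lM: "l > 0" "M > 0"
    and per: "\<forall>a\<ge>0. \<exists>\<tau>\<in>{a..a + l}. \<forall>t\<ge>M.
      ?N ((\<lambda>x. f (t + \<tau> + x)) - (\<lambda>x. f (t + x))) \<le> \<delta> powr (1 / q)"
    by (elim exE conjE) (rule that)
  show ?thesis
  proof (rule exI[of _ l], rule conjI[OF lM(1)], rule exI[of _ M], rule conjI[OF lM(2)], intro allI impI)
    fix a :: real assume a: "a \<ge> 0"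
    obtain \<tau> where \<tau>: "\<tau> \<in> {a..a + l}"
      "\<forall>t\<ge>M. ?N ((\<lambda>x. f (t + \<tau> + x)) - (\<lambda>x. f (t + x))) \<le> \<delta> powr (1 / q)"
      using per[rule_format, OF a] by (elim bexE) (rule that)
    show "\<exists>\<tau>\<in>{a..a + l}. \<forall>b\<ge>M. stepanov_diff q f \<tau> b \<le> ennreal \<delta>"
    proof (intro bexI[OF _ \<tau>(1)] allI impI)
      fix b assume b: "b \<ge> M"
      have "?N ((\<lambda>x. f (b + \<tau> + x)) - (\<lambda>x. f (b + x))) powr q \<le> (\<delta> powr (1 / q)) powr q"
        using q \<tau>(2)[rule_format, OF b] by (intro powr_mono2) (simp_all add: Lq_norm_def)
      also have "\<dots> = \<delta>" using q \<delta> by (simp add: powr_powr)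
      finally show "stepanov_diff q f \<tau> b \<le> ennreal \<delta>"
        by (subst stepanov_diff_eq_Lq_norm[OF f q]) (use \<tau>(1) a b lM(2) in \<open>simp_all add: ennreal_leI\<close>)
    qed
  qed
qed

text \<open>Membership in \<open>AAP_in\<close> includes continuity of
  \<open>\<lambda>t x. f (t + x)\<close>; here it is read at \<open>a\<close> along
  \<open>a + h\<close>.\<close>

lemma stepanov_diff_tendsto_0:
  assumes f: "f \<in> AAPS q" and q: "q \<ge> 1" and a: "a \<ge> 0"
  shows "((\<lambda>h. stepanov_diff q f h a) \<longlongrightarrow> 0) (at_right 0)"
proof -
  let ?N = "\<lambda>s. Lq_norm q (lebesgue_on {0..1}) ((\<lambda>x. f (s + x)) - (\<lambda>x. f (a + x)))"
  have "(\<lambda>t x. f (t + x)) \<in> AAP_in (Lq q (lebesgue_on {0..1})) (Lq_norm q (lebesgue_on {0..1}))"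
    using f by (simp add: AAPS_def)
  then have "(?N \<longlongrightarrow> 0) (at a within {0..})"
    unfolding AAP_in_def mem_Collect_eq using a by (elim conjE allE[of _ a]) (erule mp)
  moreover have "filterlim (\<lambda>h. a + h) (at a within {0..}) (at_right 0)"
    unfolding filterlim_at
  proof
    show "\<forall>\<^sub>F h in at_right 0. a + h \<in> {0..} \<and> a + h \<noteq> a"
      using eventually_at_right_less[of "0::real"] by eventually_elim (use a in auto)
    have "((\<lambda>h. a + h) \<longlongrightarrow> a + 0) (at_right 0)" by (intro tendsto_intros)
    then show "((\<lambda>h. a + h) \<longlongrightarrow> a) (at_right 0)" by simp
  qed
  ultimately have "((\<lambda>h. ?N (a + h)) \<longlongrightarrow> 0) (at_right 0)"
    by (rule filterlim_compose)
  then have "((\<lambda>h. ?N (a + h) powr q) \<longlongrightarrow> 0) (at_right 0)"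
    using q by (intro tendsto_zero_powrI[OF _ tendsto_const]) (auto simp: Lq_norm_def)
  then have "((\<lambda>h. ennreal (?N (a + h) powr q)) \<longlongrightarrow> 0) (at_right 0)"
    using tendsto_ennrealI by fastforce
  then show ?thesis
  proof (rule Lim_transform_eventually)
    show "\<forall>\<^sub>F h in at_right 0. ennreal (?N (a + h) powr q) = stepanov_diff q f h a"
      using eventually_at_right_less[of "0::real"]
      by eventually_elim (simp add: stepanov_diff_eq_Lq_norm[OF f q _ a])
  qed
qed

text \<open>Dominated convergence: the intervals shrink to the null set \<open>{0}\<close>.
  Monotonicity in \<open>h\<close> passes from the sequence to all small \<open>h\<close>.\<close>

lemma nn_integral_shrinking_interval:
  fixes \<phi> :: "real \<Rightarrow> ennreal"
  assumes \<phi>: "\<And>a b. (\<lambda>s. \<phi> s * indicator {a..b} s) \<in> borel_measurable lebesgue"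
    and fin: "(\<integral>\<^sup>+s. \<phi> s * indicator {0..1} s \<partial>lebesgue) < \<infinity>" and \<delta>: "\<delta> > 0"
  shows "\<forall>\<^sub>F h in at_right 0. (\<integral>\<^sup>+s. \<phi> s * indicator {0..h} s \<partial>lebesgue) < \<delta>"
proof -
  let ?u = "\<lambda>n s. \<phi> s * indicator {0..1 / real (Suc n)} s"
  have "(\<lambda>n. \<integral>\<^sup>+s. ?u n s \<partial>lebesgue) \<longlonglongrightarrow> (\<integral>\<^sup>+(s::real). 0 \<partial>lebesgue)"
  proof (rule nn_integral_dominated_convergence[where w="\<lambda>s. \<phi> s * indicator {0..1} s"])
    show "?u n \<in> borel_measurable lebesgue" for n by (rule \<phi>)
    show "(\<lambda>s. \<phi> s * indicator {0..1} s) \<in> borel_measurable lebesgue" by (rule \<phi>)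
    show "(\<integral>\<^sup>+s. \<phi> s * indicator {0..1} s \<partial>lebesgue) < \<infinity>" by (rule fin)
    show "AE s in lebesgue. ?u n s \<le> \<phi> s * indicator {0..1} s" for n
    proof (rule AE_I2)
      fix s
      have "1 / real (Suc n) \<le> 1" by simp
      then show "?u n s \<le> \<phi> s * indicator {0..1} s"
        using order_trans[of s "1 / real (Suc n)" 1] by (auto simp: indicator_def simp del: of_nat_Suc)
    qed
    show "AE s in lebesgue. (\<lambda>n. ?u n s) \<longlonglongrightarrow> 0"
      using AE_lebesgue_neq[of 0]
    proof eventually_elim
      case (elim s)
      show ?case
      proof (cases "s > 0")
        case True
        then have "\<forall>\<^sub>F n in sequentially. inverse (real (Suc n)) < s"
          using LIMSEQ_inverse_real_of_nat by (rule order_tendstoD(2)[rotated])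
        then have "\<forall>\<^sub>F n in sequentially. ?u n s = 0"
          by eventually_elim (auto simp: indicator_def inverse_eq_divide)
        then show ?thesis by (rule tendsto_eventually)
      qed (use elim in auto)
    qed
  qed simp
  then have "\<forall>\<^sub>F n in sequentially. (\<integral>\<^sup>+s. ?u n s \<partial>lebesgue) < \<delta>"
    using \<delta> by (intro order_tendstoD(2)[of _ 0]) auto
  then obtain n where n: "(\<integral>\<^sup>+s. ?u n s \<partial>lebesgue) < \<delta>"
    by (auto simp: eventually_sequentially)
  show ?thesis
    unfolding eventually_at_right_field
  proof (intro exI[of _ "1 / real (Suc n)"] conjI allI impI)
    fix h :: real assume "0 < h" "h < 1 / real (Suc n)"
    then have "(\<integral>\<^sup>+s. \<phi> s * indicator {0..h} s \<partial>lebesgue) \<le> (\<integral>\<^sup>+s. ?u n s \<partial>lebesgue)"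
      by (intro nn_integral_mono) (auto simp: indicator_def simp del: of_nat_Suc)
    then show "(\<integral>\<^sup>+s. \<phi> s * indicator {0..h} s \<partial>lebesgue) < \<delta>"
      using n by (rule order_le_less_trans)
  qed simp
qed

text \<open>Uniformity in \<open>b\<close> comes from covering the relevant part of the half-line by
  finitely many unit intervals with integer ends. The extension by zero may jump at 0; the resulting
  contribution left of 0 is an integral of \<open>f\<close> over \<open>{0..h}\<close>.\<close>

lemma stepanov_diff_small:
  fixes N :: nat
  assumes f: "f \<in> AAPS q" and q: "q \<ge> 1" and \<delta>: "\<delta> > 0"
  shows "\<exists>d>0. \<forall>h. 0 \<le> h \<and> h < d \<longrightarrow> (\<forall>b. b + 1 \<le> real N \<longrightarrow> stepanov_diff q f h b \<le> ennreal \<delta>)"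
proof -
  have loc: "f \<in> Lq_loc q" using f by (simp add: AAPS_def)
  let ?\<phi> = "\<lambda>s. ennreal (norm (half_line f s) powr q)"
  let ?g = "\<lambda>h s. norm (half_line f (h + s) - half_line f s)"
  have m: "(\<lambda>s. ?\<phi> s * indicator {a..b} s) \<in> borel_measurable lebesgue" for a b
    by (rule measurable_times_indicator[OF measurable_norm_half_line[OF loc]])
  have m': "(\<lambda>s. ennreal (?g h s powr q) * indicator {a..b} s) \<in> borel_measurable lebesgue" for h a b
    by (rule measurable_times_indicator[OF measurable_norm_half_line_diff[OF loc]])
  have le: "stepanov_diff q f h b \<le> (\<integral>\<^sup>+s. ?\<phi> s * indicator {0..h} s \<partial>lebesgue)
      + (\<Sum>n\<le>N. stepanov_diff q f h (real n))" if h: "h > 0" and b: "b + 1 \<le> real N" for h b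
  proof -
    have "stepanov_diff q f h b \<le> (\<integral>\<^sup>+s. ?\<phi> (h + s) * indicator {0..h} (h + s)
        + (\<Sum>n\<le>N. ennreal (?g h s powr q) * indicator {real n..real n + 1} s) \<partial>lebesgue)"
      unfolding stepanov_diff_def
    proof (rule nn_integral_mono)
      fix s
      show "ennreal (?g h s powr q) * indicator {b..b + 1} s \<le> ?\<phi> (h + s) * indicator {0..h} (h + s)
        + (\<Sum>n\<le>N. ennreal (?g h s powr q) * indicator {real n..real n + 1} s)" (is "?L \<le> ?A + ?S")
      proof (cases "s \<in> {b..b + 1}")
        case True
        show ?thesis
        proof (cases "s \<ge> 0")
          case s: True
          \<comment> \<open>The sum includes \<open>N\<close> because \<open>s = real N\<close> can
            occur and has floor \<open>N\<close>.\<close>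
          define n where "n = nat \<lfloor>s\<rfloor>"
          have n: "real n \<le> s" "s \<le> real n + 1" using s unfolding n_def by linarith+
          have "n \<le> N" using True b n by simp
          have "?L = ennreal (?g h s powr q) * indicator {real n..real n + 1} s"
            using True n by simp
          also have "\<dots> \<le> ?S"
            using \<open>n \<le> N\<close> by (intro member_le_sum[of n "{..N}"]) auto
          also have "\<dots> \<le> ?A + ?S" by simp
          finally show ?thesis .
        next
          case False
          \<comment> \<open>Left of 0 only the translate can be nonzero, and only if
            \<open>h + s\<close> lies in \<open>{0..h}\<close>.\<close>
          then have "half_line f s = 0" by (simp add: half_line_def)
          then have "?L \<le> ?A"
            using True False h by (cases "0 \<le> h + s") (simp_all add: half_line_def)
          also have "\<dots> \<le> ?A + ?S" by simp
          finally show ?thesis .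
        qed
      qed simp
    qed
    also have "\<dots> = (\<integral>\<^sup>+s. ?\<phi> (h + s) * indicator {0..h} (h + s) \<partial>lebesgue)
        + (\<Sum>n\<le>N. stepanov_diff q f h (real n))"
      unfolding stepanov_diff_def nn_integral_sum[OF m', symmetric]
      by (intro nn_integral_add measurable_compose[OF lebesgue_translation(1) m] borel_measurable_sum m')
    also have "(\<integral>\<^sup>+s. ?\<phi> (h + s) * indicator {0..h} (h + s) \<partial>lebesgue)
        = (\<integral>\<^sup>+s. ?\<phi> s * indicator {0..h} s \<partial>lebesgue)"
      by (rule nn_integral_translation[OF m])
    finally show ?thesis .
  qed
  obtain B where "\<And>a. (\<integral>\<^sup>+s. ?\<phi> s * indicator {a..a + 1} s \<partial>lebesgue) \<le> ennreal B"
    using stepanov_bound[OF f q] by blast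
  from this[of 0] have "(\<integral>\<^sup>+s. ?\<phi> s * indicator {0..1} s \<partial>lebesgue) < \<infinity>"
    by (simp add: order_le_less_trans)
  with m have e1: "\<forall>\<^sub>F h in at_right 0. (\<integral>\<^sup>+s. ?\<phi> s * indicator {0..h} s \<partial>lebesgue) < ennreal (\<delta> / 2)"
    by (rule nn_integral_shrinking_interval) (use \<delta> in simp)
  have "((\<lambda>h. \<Sum>n\<le>N. stepanov_diff q f h (real n)) \<longlongrightarrow> (\<Sum>n\<le>N. 0)) (at_right 0)"
    by (intro tendsto_sum stepanov_diff_tendsto_0[OF f q]) simp
  then have e2: "\<forall>\<^sub>F h in at_right 0. (\<Sum>n\<le>N. stepanov_diff q f h (real n)) < ennreal (\<delta> / 2)"
    by (rule order_tendstoD(2)) (use \<delta> in simp)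
  from e1 e2 have "\<forall>\<^sub>F h in at_right 0. (\<integral>\<^sup>+s. ?\<phi> s * indicator {0..h} s \<partial>lebesgue)
      + (\<Sum>n\<le>N. stepanov_diff q f h (real n)) \<le> ennreal \<delta>"
  proof eventually_elim
    case (elim h)
    then have "(\<integral>\<^sup>+s. ?\<phi> s * indicator {0..h} s \<partial>lebesgue)
      + (\<Sum>n\<le>N. stepanov_diff q f h (real n)) \<le> ennreal (\<delta> / 2) + ennreal (\<delta> / 2)"
      by (intro add_mono less_imp_le)
    also have "\<dots> = ennreal \<delta>" using \<delta> by (simp flip: ennreal_plus)
    finally show ?case .
  qed
  then obtain d where d: "d > 0" "\<And>h. 0 < h \<Longrightarrow> h < d \<Longrightarrow> (\<integral>\<^sup>+s. ?\<phi> s * indicator {0..h} s \<partial>lebesgue)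
      + (\<Sum>n\<le>N. stepanov_diff q f h (real n)) \<le> ennreal \<delta>"
    by (auto simp: eventually_at_right_field)
  show ?thesis
  proof (intro exI[of _ d] conjI allI impI d(1))
    fix h b :: real assume "0 \<le> h \<and> h < d" and b: "b + 1 \<le> real N"
    \<comment> \<open>The limits from the right say nothing about \<open>h = 0\<close>, where the
      difference vanishes.\<close>
    then consider "h = 0" | "0 < h" "h < d" by linarith
    then show "stepanov_diff q f h b \<le> ennreal \<delta>"
    proof cases
      case 1
      then show ?thesis using q by (simp add: stepanov_diff_def)
    next
      case 2
      then show ?thesis using le[OF _ b] d(2) order_trans by blast
    qed
  qed
qed

section \<open>The convolution\<close>

lemma stepanov_kernel_nn_integral_finite:
  assumes k: "stepanov_kernel \<rho> q k" and f: "f \<in> AAPS q" and q: "q \<ge> 1"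
  shows "(\<integral>\<^sup>+s. ennreal (k (t - s) * norm (half_line f s)) * indicator {..<t} s \<partial>lebesgue) < \<infinity>"
proof -
  have loc: "f \<in> Lq_loc q" using f by (simp add: AAPS_def)
  obtain B where B: "B \<ge> 0"
    "\<And>a. (\<integral>\<^sup>+s. ennreal (norm (half_line f s) powr q) * indicator {a..a + 1} s \<partial>lebesgue) \<le> ennreal B"
    using stepanov_bound[OF f q] by blast
  \<comment> \<open>Any finite bound will do, so the kernel is used with \<eta> = 1, the uniform
    local bound as \<delta>, and \<open>b = 0\<close>.\<close>
  have E: "\<forall>j::nat. (\<integral>\<^sup>+s. ennreal (norm (half_line f s) powr q) * indicator {t - j - 1..t - j} s \<partial>lebesgue)
        \<le> ennreal (B + 0 * exp (\<rho> * j))"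
    using B(2)[of "t - real _ - 1"] by simp
  obtain c where "(\<integral>\<^sup>+s. ennreal (k (t - s) * norm (half_line f s)) * indicator {..<t} s \<partial>lebesgue)
      \<le> ennreal (1 + c * (B + 0))"
    using k[unfolded stepanov_kernel_def, rule_format, OF zero_less_one]
      measurable_norm_half_line[OF loc] norm_ge_zero B(1) order_refl E by meson
  then show ?thesis by (simp add: order_le_less_trans)
qed

lemma convolution_integrable:
  fixes R :: "real \<Rightarrow> 'a::banach \<Rightarrow>\<^sub>L 'b::banach"
  assumes cont: "\<And>x. continuous_on {0<..} (\<lambda>t. blinfun_apply (R t) x)"
    and bdd: "\<And>a b. 0 < a \<Longrightarrow> \<exists>B. \<forall>t\<in>{a..b}. norm (R t) \<le> B"
    and Rk: "\<And>t. t > 0 \<Longrightarrow> norm (R t) \<le> k t" and k: "stepanov_kernel \<rho> q k"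
    and f: "f \<in> AAPS q" and q: "q \<ge> 1" and t: "t \<ge> 0"
  shows "strong_bochner_integrable (lebesgue_on {0..t}) (\<lambda>s. blinfun_apply (R (t - s)) (f s))"
proof (rule strong_bochner_integrableI)
  have "strongly_measurable (lebesgue_on {0..t}) f"
    using f t by (simp add: AAPS_def Lq_loc_def Lq_def)
  then show "strongly_measurable (lebesgue_on {0..t}) (\<lambda>s. blinfun_apply (R (t - s)) (f s))"
    by (intro strongly_measurable_blinfun_apply cont bdd)
  have "(\<integral>\<^sup>+s. norm (blinfun_apply (R (t - s)) (f s)) \<partial>lebesgue_on {0..t})
      = (\<integral>\<^sup>+s. ennreal (norm (blinfun_apply (R (t - s)) (f s))) * indicator {0..t} s \<partial>lebesgue)"
    by (rule nn_integral_restrict_space) simp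
  also have "\<dots> \<le> (\<integral>\<^sup>+s. ennreal (k (t - s) * norm (half_line f s)) * indicator {..<t} s \<partial>lebesgue)"
  proof (rule nn_integral_mono_AE)
    show "AE s in lebesgue. ennreal (norm (blinfun_apply (R (t - s)) (f s))) * indicator {0..t} s
        \<le> ennreal (k (t - s) * norm (half_line f s)) * indicator {..<t} s"
      \<comment> \<open>The bound on \<open>R\<close> holds at positive times only, so the point
        \<open>s = t\<close> is dropped.\<close>
      using AE_lebesgue_neq[of t]
    proof eventually_elim
      case (elim s)
      show ?case
      proof (cases "0 \<le> s \<and> s < t")
        case True
        then have "norm (blinfun_apply (R (t - s)) (f s)) \<le> k (t - s) * norm (f s)"
          by (intro order_trans[OF norm_blinfun] mult_right_mono Rk) auto
        then show ?thesis using True by (simp add: half_line_def ennreal_leI)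
      qed (use elim in auto)
    qed
  qed
  also have "\<dots> < \<infinity>"
    by (rule stepanov_kernel_nn_integral_finite[OF k f q])
  finally show "(\<integral>\<^sup>+s. norm (blinfun_apply (R (t - s)) (f s)) \<partial>lebesgue_on {0..t}) < \<infinity>" .
qed

lemma convolution_diff_le:
  fixes R :: "real \<Rightarrow> 'a::banach \<Rightarrow>\<^sub>L 'b::banach"
  assumes Rk: "\<And>t. t > 0 \<Longrightarrow> norm (R t) \<le> k t" and \<tau>: "\<tau> \<ge> 0"
    and I: "has_strong_bochner_integral (lebesgue_on {0..t + \<tau>}) (\<lambda>s. blinfun_apply (R (t + \<tau> - s)) (f s)) I"
    and J: "has_strong_bochner_integral (lebesgue_on {0..t}) (\<lambda>s. blinfun_apply (R (t - s)) (f s)) J"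
  shows "ennreal (norm (I - J)) \<le> (\<integral>\<^sup>+s. ennreal (k (t - s) * norm (half_line f (\<tau> + s) - half_line f s))
    * indicator {..<t} s \<partial>lebesgue)"
proof -
  let ?F = "\<lambda>s. indicator {0..t + \<tau>} s *\<^sub>R blinfun_apply (R (t + \<tau> - s)) (f s)"
  let ?G = "\<lambda>s. indicator {0..t} s *\<^sub>R blinfun_apply (R (t - s)) (f s)"
  have "has_strong_bochner_integral lebesgue ?F I"
    by (rule has_strong_bochner_integral_restrict_space[OF _ I]) simp
  then have F: "has_strong_bochner_integral lebesgue (\<lambda>s. ?F (\<tau> + s)) I"
    by (rule has_strong_bochner_integral_comp[OF lebesgue_translation])
  have G: "has_strong_bochner_integral lebesgue ?G J"
    by (rule has_strong_bochner_integral_restrict_space[OF _ J]) simp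
  have "ennreal (norm (I - J)) \<le> (\<integral>\<^sup>+s. norm (?F (\<tau> + s) - ?G s) \<partial>lebesgue)"
    by (rule has_strong_bochner_integral_dist_le[OF F G])
  also have "\<dots> \<le> (\<integral>\<^sup>+s. ennreal (k (t - s) * norm (half_line f (\<tau> + s) - half_line f s))
    * indicator {..<t} s \<partial>lebesgue)"
  proof (rule nn_integral_mono_AE)
    show "AE s in lebesgue. ennreal (norm (?F (\<tau> + s) - ?G s))
        \<le> ennreal (k (t - s) * norm (half_line f (\<tau> + s) - half_line f s)) * indicator {..<t} s"
      using AE_lebesgue_neq[of t]
    proof eventually_elim
      case (elim s)
      show ?case
      proof (cases "s < t")
        case True
        \<comment> \<open>For \<open>s < t\<close> the upper limit of integration holds
          automatically; the lower one is what \<open>half_line\<close> encodes.\<close>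
        have "?F (\<tau> + s) = blinfun_apply (R (t - s)) (half_line f (\<tau> + s))"
          using True \<tau> by (auto simp: half_line_def indicator_def blinfun.zero_right)
        moreover have "?G s = blinfun_apply (R (t - s)) (half_line f s)"
          using True by (auto simp: half_line_def indicator_def blinfun.zero_right)
        ultimately have "norm (?F (\<tau> + s) - ?G s)
            = norm (blinfun_apply (R (t - s)) (half_line f (\<tau> + s) - half_line f s))"
          by (simp add: blinfun.diff_right)
        also have "\<dots> \<le> k (t - s) * norm (half_line f (\<tau> + s) - half_line f s)"
          using True by (intro order_trans[OF norm_blinfun] mult_right_mono Rk) auto
        finally show ?thesis using True by (simp add: ennreal_leI)
      qed (use elim in auto)
    qed
  qed
  finally show ?thesis .
qed

text \<open>All three properties are instances of \<open>est\<close>: boundedness takes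
  \<open>t = 0\<close> and a large \<delta>, continuity takes \<open>b = 0\<close> and small \<tau>,
  and almost periodicity needs a positive \<open>b\<close>.\<close>

lemma AAP_convolution:
  fixes R :: "real \<Rightarrow> 'a::banach \<Rightarrow>\<^sub>L 'b::banach"
  assumes H: "\<And>t. t \<ge> 0 \<Longrightarrow>
      has_strong_bochner_integral (lebesgue_on {0..t}) (\<lambda>s. blinfun_apply (R (t - s)) (f s)) (H t)"
    and Rk: "\<And>t. t > 0 \<Longrightarrow> norm (R t) \<le> k t" and k: "stepanov_kernel \<rho> q k" and \<rho>: "\<rho> > 0"
    and f: "f \<in> AAPS q" and q: "q \<ge> 1"
  shows "H \<in> AAP"
proof -
  have loc: "f \<in> Lq_loc q" using f by (simp add: AAPS_def)
  have est: "\<exists>c\<ge>0. \<forall>t\<ge>0. \<forall>\<tau>\<ge>0. \<forall>\<delta>\<ge>0. \<forall>b\<ge>0.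
      (\<forall>j::nat. stepanov_diff q f \<tau> (t - j - 1) \<le> ennreal (\<delta> + b * exp (\<rho> * j)))
      \<longrightarrow> norm (H (t + \<tau>) - H t) \<le> \<eta> + c * (\<delta> + b)" if \<eta>: "\<eta> > 0" for \<eta>
  proof -
    obtain c where c: "c \<ge> 0" and ker: "\<forall>t g \<delta> b.
      g \<in> borel_measurable lebesgue \<longrightarrow> (\<forall>s. 0 \<le> g s) \<longrightarrow> 0 \<le> \<delta> \<longrightarrow> 0 \<le> b \<longrightarrow>
      (\<forall>j::nat. (\<integral>\<^sup>+s. ennreal (g s powr q) * indicator {t - j - 1..t - j} s \<partial>lebesgue)
          \<le> ennreal (\<delta> + b * exp (\<rho> * j))) \<longrightarrow>
      (\<integral>\<^sup>+s. ennreal (k (t - s) * g s) * indicator {..<t} s \<partial>lebesgue) \<le> ennreal (\<eta> + c * (\<delta> + b))"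
      using k \<eta> unfolding stepanov_kernel_def by blast
    show ?thesis
    proof (intro exI[of _ c] conjI allI impI c)
      fix t \<tau> \<delta> b :: real
      assume t: "0 \<le> t" and \<tau>: "0 \<le> \<tau>" and \<delta>: "0 \<le> \<delta>" and b: "0 \<le> b"
        and E: "\<forall>j::nat. stepanov_diff q f \<tau> (t - j - 1) \<le> ennreal (\<delta> + b * exp (\<rho> * j))"
      have E': "(\<integral>\<^sup>+s. ennreal (norm (half_line f (\<tau> + s) - half_line f s) powr q)
          * indicator {t - j - 1..t - j} s \<partial>lebesgue) \<le> ennreal (\<delta> + b * exp (\<rho> * j))" for j :: nat
        using E[rule_format, of j] by (simp add: stepanov_diff_def)
      have "ennreal (norm (H (t + \<tau>) - H t)) \<le> (\<integral>\<^sup>+s. ennreal (k (t - s)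
          * norm (half_line f (\<tau> + s) - half_line f s)) * indicator {..<t} s \<partial>lebesgue)"
        by (rule convolution_diff_le[OF Rk \<tau> H H]) (use t \<tau> in auto)
      also have "\<dots> \<le> ennreal (\<eta> + c * (\<delta> + b))"
        by (rule ker[rule_format, OF measurable_norm_half_line_diff[OF loc] norm_ge_zero \<delta> b E'])
      finally show "norm (H (t + \<tau>) - H t) \<le> \<eta> + c * (\<delta> + b)"
        using ennreal_le_iff[of "\<eta> + c * (\<delta> + b)"] \<eta> c \<delta> b by (meson add_nonneg_nonneg less_imp_le mult_nonneg_nonneg)
    qed
  qed
  \<comment> \<open>A third of \<epsilon> each for \<eta>, \<open>c * \<delta>\<close> and
    \<open>c * b\<close>. Since \<open>c\<close> depends on \<eta>, \<delta> is chosen after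
    both.\<close>
  have small: "\<exists>\<delta>>0. \<forall>t\<ge>0. \<forall>\<tau>\<ge>0. \<forall>b\<ge>0. b \<le> \<delta> \<longrightarrow>
      (\<forall>j::nat. stepanov_diff q f \<tau> (t - j - 1) \<le> ennreal (\<delta> + b * exp (\<rho> * j)))
      \<longrightarrow> norm (H (t + \<tau>) - H t) \<le> \<epsilon>" if \<epsilon>: "\<epsilon> > 0" for \<epsilon>
  proof -
    obtain c where c: "c \<ge> 0" "\<forall>t\<ge>0. \<forall>\<tau>\<ge>0. \<forall>\<delta>\<ge>0. \<forall>b\<ge>0.
        (\<forall>j::nat. stepanov_diff q f \<tau> (t - j - 1) \<le> ennreal (\<delta> + b * exp (\<rho> * j)))
        \<longrightarrow> norm (H (t + \<tau>) - H t) \<le> \<epsilon> / 3 + c * (\<delta> + b)"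
      using est[of "\<epsilon> / 3"] \<epsilon> by auto
    \<comment> \<open>The denominator has \<open>c + 1\<close> because \<open>c\<close> may be
      0.\<close>
    define \<delta> where "\<delta> = \<epsilon> / (3 * (c + 1))"
    have \<delta>: "\<delta> > 0" using \<epsilon> c(1) by (simp add: \<delta>_def)
    have c\<delta>: "c * \<delta> \<le> \<epsilon> / 3"
    proof -
      have "c * \<delta> \<le> (c + 1) * \<delta>" using \<delta> by simp
      also have "\<dots> = \<epsilon> / 3" using c(1) by (simp add: \<delta>_def field_simps)
      finally show ?thesis .
    qed
    show ?thesis
    proof (intro exI[of _ \<delta>] conjI allI impI \<delta>)
      fix t \<tau> b :: real
      assume "0 \<le> t" "0 \<le> \<tau>" "0 \<le> b" and b: "b \<le> \<delta>"
        and "\<forall>j::nat. stepanov_diff q f \<tau> (t - j - 1) \<le> ennreal (\<delta> + b * exp (\<rho> * j))"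
      then have "norm (H (t + \<tau>) - H t) \<le> \<epsilon> / 3 + c * (\<delta> + b)"
        using c(2) less_imp_le[OF \<delta>] by blast
      also have "\<dots> \<le> \<epsilon> / 3 + c * (\<delta> + \<delta>)"
        using b c(1) by (intro add_left_mono mult_left_mono) auto
      finally show "norm (H (t + \<tau>) - H t) \<le> \<epsilon>" using c\<delta> by (simp add: distrib_left)
    qed
  qed
  obtain B where B: "B > 0" "\<And>\<tau> a. stepanov_diff q f \<tau> a \<le> ennreal B"
    using stepanov_diff_bound[OF f q] by blast
  have "bounded (H ` {0..})"
  proof -
    obtain c where c: "c \<ge> 0" "\<forall>t\<ge>0. \<forall>\<tau>\<ge>0. \<forall>\<delta>\<ge>0. \<forall>b\<ge>0.
        (\<forall>j::nat. stepanov_diff q f \<tau> (t - j - 1) \<le> ennreal (\<delta> + b * exp (\<rho> * j)))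
        \<longrightarrow> norm (H (t + \<tau>) - H t) \<le> 1 + c * (\<delta> + b)"
      using est[of 1] by auto
    \<comment> \<open>The base point is 0 and the time itself serves as the translation; all local
      norms of differences are at most \<open>B\<close>.\<close>
    have "norm (H \<tau>) \<le> norm (H 0) + (1 + c * (B + 0))" if "\<tau> \<ge> 0" for \<tau>
    proof -
      have "norm (H (0 + \<tau>) - H 0) \<le> 1 + c * (B + 0)"
        by (rule c(2)[rule_format]) (use that B in auto)
      then show ?thesis using norm_triangle_ineq2[of "H \<tau>" "H 0"] by simp
    qed
    then show ?thesis unfolding bounded_iff by auto
  qed
  moreover have "continuous_on {0..} H"
    unfolding continuous_on_iff
  proof (intro ballI allI impI)
    fix x \<epsilon> :: real assume x: "x \<in> {0..}" and \<epsilon>: "\<epsilon> > 0"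
    obtain \<delta> where \<delta>: "\<delta> > 0" and close: "\<And>t \<tau> b. 0 \<le> t \<Longrightarrow> 0 \<le> \<tau> \<Longrightarrow> 0 \<le> b \<Longrightarrow> b \<le> \<delta> \<Longrightarrow>
        \<forall>j::nat. stepanov_diff q f \<tau> (t - j - 1) \<le> ennreal (\<delta> + b * exp (\<rho> * j)) \<Longrightarrow>
        norm (H (t + \<tau>) - H t) \<le> \<epsilon> / 2"
      using small[of "\<epsilon> / 2"] \<epsilon> by auto
    obtain N :: nat where N: "x + 1 \<le> real N" using real_arch_simple by blast
    obtain d where d: "d > 0"
      "\<And>h b. 0 \<le> h \<Longrightarrow> h < d \<Longrightarrow> b + 1 \<le> real N \<Longrightarrow> stepanov_diff q f h b \<le> ennreal \<delta>"
      using stepanov_diff_small[OF f q \<delta>, of N] by blast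
    \<comment> \<open>Only intervals ending at or before \<open>t\<close> enter, so smallness left
      of \<open>N\<close> suffices for all base points \<open>t\<close> at once. Continuity from the
      left relies on this, as there the base point is the moving \<open>y\<close>.\<close>
    have main: "norm (H (t + h) - H t) < \<epsilon>" if "0 \<le> t" "0 \<le> h" "h < d" "t \<le> real N" for t h
    proof -
      have "norm (H (t + h) - H t) \<le> \<epsilon> / 2"
        by (rule close[of _ _ 0]) (use that \<delta> d(2) in auto)
      then show ?thesis using \<epsilon> by simp
    qed
    show "\<exists>d>0. \<forall>y\<in>{0..}. dist y x < d \<longrightarrow> dist (H y) (H x) < \<epsilon>"
    proof (intro exI[of _ "min d 1"] conjI ballI impI)
      fix y assume y: "y \<in> {0..}" "dist y x < min d 1"
      show "dist (H y) (H x) < \<epsilon>"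
      proof (cases "y \<le> x")
        case True
        then show ?thesis
          using main[of y "x - y"] x y N by (simp add: dist_norm norm_minus_commute)
      next
        case False
        then show ?thesis
          using main[of x "y - x"] x y N by (simp add: dist_norm)
      qed
    qed (use d in simp)
  qed
  moreover have "\<exists>l>0. \<exists>M>0. \<forall>a\<ge>0. \<exists>\<tau>\<in>{a..a + l}. \<forall>t\<ge>M. norm (H (t + \<tau>) - H t) \<le> \<epsilon>"
    if \<epsilon>: "\<epsilon> > 0" for \<epsilon>
  proof -
    obtain \<delta> where \<delta>: "\<delta> > 0" and close: "\<And>t \<tau> b. 0 \<le> t \<Longrightarrow> 0 \<le> \<tau> \<Longrightarrow> 0 \<le> b \<Longrightarrow> b \<le> \<delta> \<Longrightarrow>
        \<forall>j::nat. stepanov_diff q f \<tau> (t - j - 1) \<le> ennreal (\<delta> + b * exp (\<rho> * j)) \<Longrightarrow>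
        norm (H (t + \<tau>) - H t) \<le> \<epsilon>"
      using small[of "\<epsilon>"] \<epsilon> by auto
    obtain l M where lM: "l > 0" "M > 0"
      and per: "\<forall>a\<ge>0. \<exists>\<tau>\<in>{a..a + l}. \<forall>b\<ge>M. stepanov_diff q f \<tau> b \<le> ennreal \<delta>"
      using stepanov_diff_almost_period[OF f q \<delta>] by auto
    \<comment> \<open>So large that \<open>B / \<delta> \<le> \<rho> * (t - M - 1)\<close> for
      \<open>t \<ge> L\<close>; then \<open>y \<le> exp y\<close> gives
      \<open>b \<le> \<delta>\<close> below.\<close>
    define L where "L = M + 1 + B / (\<delta> * \<rho>)"
    have L: "L > 0" using lM(2) B(1) \<delta> \<rho> by (simp add: L_def add_pos_pos)
    have "norm (H (t + \<tau>) - H t) \<le> \<epsilon>"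
      if \<tau>: "\<tau> \<ge> 0" and E: "\<forall>b\<ge>M. stepanov_diff q f \<tau> b \<le> ennreal \<delta>" and t: "t \<ge> L" for \<tau> t
    proof -
      \<comment> \<open>Chosen so that \<open>b * exp (\<rho> * j)\<close> reaches \<open>B\<close>
        as soon as \<open>t - j - 1 < M\<close>, that is, on the intervals about which the almost
        period says nothing.\<close>
      define b where "b = B * exp (- \<rho> * (t - M - 1))"
      have b0: "b \<ge> 0" using B(1) by (simp add: b_def)
      have "B / \<delta> \<le> \<rho> * (t - M - 1)"
        using t \<rho> \<delta> by (simp add: L_def field_simps)
      also have "\<dots> \<le> exp (\<rho> * (t - M - 1))"
        using exp_ge_add_one_self[of "\<rho> * (t - M - 1)"] by linarith
      finally have "B \<le> \<delta> * exp (\<rho> * (t - M - 1))"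
        using \<delta> by (simp add: field_simps)
      then have "b \<le> \<delta> * exp (\<rho> * (t - M - 1)) * exp (- \<rho> * (t - M - 1))"
        unfolding b_def by (intro mult_right_mono) auto
      also have "\<dots> = \<delta>" by (simp add: mult.assoc flip: exp_add)
      finally have b: "b \<le> \<delta>" .
      have "stepanov_diff q f \<tau> (t - real j - 1) \<le> ennreal (\<delta> + b * exp (\<rho> * real j))" for j :: nat
      proof (cases "t - real j - 1 \<ge> M")
        case True
        then have "stepanov_diff q f \<tau> (t - real j - 1) \<le> ennreal \<delta>" using E by blast
        also have "\<dots> \<le> ennreal (\<delta> + b * exp (\<rho> * real j))"
          using b0 by (intro ennreal_leI) simp
        finally show ?thesis .
      next
        case False
        have "b * exp (\<rho> * real j) = B * exp (\<rho> * (real j - (t - M - 1)))"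
          by (simp add: b_def mult.assoc algebra_simps flip: exp_add)
        moreover have "1 \<le> exp (\<rho> * (real j - (t - M - 1)))"
          using False \<rho> by simp
        ultimately have "B \<le> b * exp (\<rho> * real j)"
          using B(1) by simp
        then have "ennreal B \<le> ennreal (\<delta> + b * exp (\<rho> * real j))"
          using \<delta> by (intro ennreal_leI) simp
        then show ?thesis using B(2) order_trans by blast
      qed
      then show ?thesis
        by (intro close[of _ _ b]) (use t L \<tau> b0 b in auto)
    qed
    note bound = this
    show ?thesis
    proof (rule exI[of _ l], rule conjI[OF lM(1)], rule exI[of _ L], rule conjI[OF L], intro allI impI)
      fix a :: real assume a: "a \<ge> 0"
      obtain \<tau> where "\<tau> \<in> {a..a + l}" "\<forall>b\<ge>M. stepanov_diff q f \<tau> b \<le> ennreal \<delta>"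
        using per a by blast
      then show "\<exists>\<tau>\<in>{a..a + l}. \<forall>t\<ge>L. norm (H (t + \<tau>) - H t) \<le> \<epsilon>"
        using bound a by (intro bexI[of _ \<tau>]) auto
    qed
  qed
  ultimately show ?thesis
    unfolding AAP_def by blast
qed

theorem lemma2p7:
  fixes R :: "real \<Rightarrow> 'a::complex_banach \<Rightarrow>\<^sub>L 'a"
    and f :: "real \<Rightarrow> 'a"
    and \<omega> \<beta> q q' :: real
  assumes "\<forall>t>0. R t \<in> complex_operators"
    and "\<forall>x. continuous_on {0<..} (\<lambda>t. blinfun_apply (R t) x)"
    and "\<omega> > 0" and "\<beta> > 0"
    and "\<exists>C. \<forall>t>0. norm (R t) \<le> C * exp (- \<omega> * t) * t powr (\<beta> - 1)"
    and "q \<ge> 1"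
    and "f \<in> AAPS q"
    and "q > 1 \<longrightarrow> 1 / q + 1 / q' = 1 \<and> q' * (\<beta> - 1) > -1"
    and "q = 1 \<longrightarrow> \<beta> = 1"
  shows "(\<forall>t\<ge>0. strong_bochner_integrable (lebesgue_on {0..t}) (\<lambda>s. blinfun_apply (R (t - s)) (f s))) \<and>
    (\<lambda>t. strong_bochner_integral (lebesgue_on {0..t}) (\<lambda>s. blinfun_apply (R (t - s)) (f s))) \<in> AAP"
proof -
  obtain C where C: "\<And>t. t > 0 \<Longrightarrow> norm (R t) \<le> C * exp (- \<omega> * t) * t powr (\<beta> - 1)"
    using assms(5) by blast
  \<comment> \<open>A singularity at 0, present for \<beta> < 1, is kept; a growing power, present
    for \<beta> > 1, is replaced by the constant \<open>A\<close> at the cost of half the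
    rate.\<close>
  define \<gamma> where "\<gamma> = min (\<beta> - 1) 0"
  \<comment> \<open>The constant of \<open>powr_le_exp\<close> for the power
    \<open>\<beta> - 1\<close> and the rate \<open>\<omega> / 2\<close>.\<close>
  define A where "A = (if \<beta> > 1 then ((\<beta> - 1) / (\<omega> / 2)) powr (\<beta> - 1) else 1)"
  have A: "exp (- \<omega> * s) * s powr (\<beta> - 1) \<le> A * (exp (- (\<omega> / 2) * s) * s powr \<gamma>)" if s: "s > 0" for s
  proof (cases "\<beta> > 1")
    case True
    have "exp (- \<omega> * s) * s powr (\<beta> - 1) \<le> exp (- \<omega> * s) * (A * exp (\<omega> / 2 * s))"
      using powr_le_exp[of "\<beta> - 1" "\<omega> / 2" s] True s assms(3)
      by (intro mult_left_mono) (auto simp: A_def)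
    also have "\<dots> = A * exp (- (\<omega> / 2) * s)"
      by (simp add: mult.left_commute flip: exp_add)
    finally show ?thesis using True s by (simp add: \<gamma>_def)
  next
    case False
    then show ?thesis using s assms(3) by (auto simp: A_def \<gamma>_def intro!: mult_right_mono)
  qed
  let ?k = "\<lambda>s. exp (- (\<omega> / 2) * s) * s powr \<gamma>"
  have "q' * \<gamma> > -1" if "q > 1"
    using that assms(8) by (auto simp: \<gamma>_def min_def)
  \<comment> \<open>The rate is halved twice, once to absorb the power and once in
    \<open>stepanov_kernel_exp_powr\<close>.\<close>
  then have k0: "stepanov_kernel (\<omega> / 2 / 2) q ?k"
    using assms(3,6,8,9) by (intro stepanov_kernel_exp_powr[where q'=q']) (auto simp: \<gamma>_def)
  define D where "D = \<bar>C\<bar> * A"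
  have "A \<ge> 0" by (simp add: A_def)
  have Rk: "norm (R t) \<le> D * ?k t" if t: "t > 0" for t
  proof -
    have "norm (R t) \<le> C * (exp (- \<omega> * t) * t powr (\<beta> - 1))"
      using C[OF t] by (simp only: mult.assoc)
    also have "\<dots> \<le> \<bar>C\<bar> * (exp (- \<omega> * t) * t powr (\<beta> - 1))"
      by (intro mult_right_mono) auto
    also have "\<dots> \<le> \<bar>C\<bar> * (A * ?k t)" by (intro mult_left_mono A t) simp
    finally show ?thesis by (simp add: D_def mult.assoc)
  qed
  have k: "stepanov_kernel (\<omega> / 2 / 2) q (\<lambda>s. D * ?k s)"
    by (rule stepanov_kernel_dominated[OF k0, of D]) (simp_all add: D_def \<open>A \<ge> 0\<close>)
  \<comment> \<open>As \<gamma> \<le> 0, the power in the dominating kernel is largest at the left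
    end of the interval.\<close>
  have bdd: "\<exists>B. \<forall>t\<in>{a..b}. norm (R t) \<le> B" if "0 < a" for a b
  proof -
    have "norm (R t) \<le> D * a powr \<gamma>" if t: "t \<in> {a..b}" for t
    proof -
      have "?k t \<le> 1 * a powr \<gamma>"
        using t \<open>0 < a\<close> assms(3) by (intro mult_mono powr_mono2') (auto simp: \<gamma>_def)
      then show ?thesis
        using Rk[of t] t \<open>0 < a\<close> mult_left_mono[of "?k t" "a powr \<gamma>" D] \<open>A \<ge> 0\<close>
        by (simp add: D_def)
    qed
    then show ?thesis by blast
  qed
  have int: "strong_bochner_integrable (lebesgue_on {0..t}) (\<lambda>s. blinfun_apply (R (t - s)) (f s))"
    if "t \<ge> 0" for t
    by (rule convolution_integrable[OF assms(2)[rule_format] bdd Rk k assms(7,6) that])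
  have "has_strong_bochner_integral (lebesgue_on {0..t}) (\<lambda>s. blinfun_apply (R (t - s)) (f s))
      (strong_bochner_integral (lebesgue_on {0..t}) (\<lambda>s. blinfun_apply (R (t - s)) (f s)))" if "t \<ge> 0" for t
    using int[OF that] strong_bochner_integral_eq unfolding strong_bochner_integrable_def by metis
  then have "(\<lambda>t. strong_bochner_integral (lebesgue_on {0..t}) (\<lambda>s. blinfun_apply (R (t - s)) (f s))) \<in> AAP"
    by (rule AAP_convolution[OF _ Rk k _ assms(7,6)]) (use assms(3) in simp_all)
  with int show ?thesis by blast
qed

end
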